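(* Let $\mathcal H=\mathrm{Forb}(\mathcal F)$ be a non-trivial hereditary property, where $\mathcal F$ is a non-empty family of graphs, fix $p\in(0,1/2)$, and suppose that there is a sequence of CRGs $(\Gamma_n)_{n\in\mathbb N}$ with the following properties: (I) there is a sequence $p_n\to p$ for which $\Gamma_n\in\mathcal K_{p_n}(\mathcal H)$ for all $n$; (II) $\limsup_{n\to\infty}|VW(\Gamma_n)|=w$; (III) the $\Gamma_n$'s are pairwise distinct (i.e. pairwise non-isomorphic as CRGs). Then there is a $p$-core CRG $K$ with the following properties: (1) $K\in\mathcal K_p(\mathcal H)$; (2) $g_K(p)\leq\limsup_{n\to\infty}g_{\Gamma_n}(p_n)$; (3) $|VW(K)|=s>w$; (4) for any integer $1\leq r\leq s-w$ and any positive integer $\ell$, $\mathcal F\not\mapsto K^\ell(r)$.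
   Context: All graphs are finite and simple. For a family $\mathcal F$ of graphs, $\mathrm{Forb}(\mathcal F)$ is the family of all graphs containing no member of $\mathcal F$ as an induced subgraph. A hereditary property is a family of graphs closed under isomorphism and vertex-deletion (each is of the form $\mathrm{Forb}(\mathcal F)$); it is non-trivial if it contains graphs of unbounded order. A colored regularity graph (CRG) $K$ is a finite non-empty clique together with a partition of its vertices into black and white, $V(K)=VB(K)\sqcup VW(K)$, and a partition of its edges into black, white and gray, $E(K)=EB(K)\sqcup EW(K)\sqcup EG(K)$. A sub-CRG is the CRG induced on a non-empty subset of the vertices. For a graph $F$, write $F\mapsto K$ if there is a function $\phi\colon V(F)\to V(K)$ such that: for every $uv\in E(F)$, either $\phi(u)=\phi(v)\in VB(K)$ or $\phi(u)\phi(v)\in EB(K)\cup EG(K)$; and for every pair of distinct $u,v$ with $uv\notin E(F)$, either $\phi(u)=\phi(v)\in VW(K)$ or $\phi(u)\phi(v)\in EW(K)\cup EG(K)$. Write $\mathcal F\mapsto K$ if $F\mapsto K$ for some $F\in\mathcal F$, and $\mathcal F\not\mapsto K$ otherwise. For $p\in[0,1]$, $M_K(p)\in\mathbb R^{V(K)\times V(K)}$ is the matrix whose $(x,y)$ entry is $p$ if $x=y\in VW(K)$ or $xy\in EW(K)$; $1-p$ if $x=y\in VB(K)$ or $xy\in EB(K)$; and $0$ if $xy\in EG(K)$. Set $g_K(p)=\min\{\langle\mu,M_K(p)\mu\rangle:\mu\in\Delta^K\}$, where $\Delta^K$ is the set of all probability masses on $V(K)$. For $p\in(0,1)$, $K$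 is $p$-core if $g_{K'}(p)>g_K(p)$ for every proper sub-CRG $K'\subset K$. $K$ is $0$-core if it has only white and gray edges and $EW(K)\subseteq\binom{VB(K)}{2}$ (every white edge joins two black vertices); $K$ is $1$-core if it has only black and gray edges and $EB(K)\subseteq\binom{VW(K)}{2}$. It is known that every $p$-core CRG with $p\in(0,1/2]$ is $0$-core. For $p\in[0,1]$, $\mathcal K_p(\mathcal H)$ is the set of all $p$-core CRGs $K$ with $\mathcal F\not\mapsto K$. A dalmatian CRG of size $\ell$ is a CRG consisting of $\ell$ black vertices with all edges white. For a $0$-core CRG $K$ and integers $\ell\ge1$, $1\le r\le|VW(K)|$, the CRG $K^\ell(r)$ is obtained by replacing $r$ of $K$'s white vertices by dalmatian CRGs of size $\ell$ and otherwise leaving $K$ unchanged. (Each edge at a white vertex of a $0$-core CRG is gray, so all edges from a new dalmatian CRG to vertices outside it are gray; the choice of the $r$ white vertices does not matter up to isomorphism.) *)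

theory Defs
  imports "HOL-Analysis.Analysis" "HOL-Library.Ramsey"
begin

section \<open>Graphs and hereditary properties\<close>

record 'a graph =
  verts :: "'a set"
  edges :: "'a set set"

definition simple_graph :: "'a graph \<Rightarrow> bool" where
  "simple_graph G \<longleftrightarrow> finite (verts G) \<and> edges G \<subseteq> nsets (verts G) 2"

definition contains_induced :: "'a graph \<Rightarrow> 'b graph \<Rightarrow> bool" where
  "contains_induced G F \<longleftrightarrow>
     (\<exists>f. inj_on f (verts F) \<and> f ` verts F \<subseteq> verts G \<and>
          (\<forall>u\<in>verts F. \<forall>v\<in>verts F. {u, v} \<in> edges F \<longleftrightarrow> {f u, f v} \<in> edges G))"

text \<open>Vertices are natural numbers: every finite graph, and every CRG, is isomorphic to one of
  this kind.\<close>

definition Forb :: "nat graph set \<Rightarrow> nat graph set" where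
  "Forb \<F> = {G. simple_graph G \<and> (\<forall>F\<in>\<F>. \<not> contains_induced G F)}"

definition nontrivial_property :: "nat graph set \<Rightarrow> bool" where
  "nontrivial_property \<H> \<longleftrightarrow> (\<forall>n. \<exists>G\<in>\<H>. n \<le> card (verts G))"


section \<open>Colored regularity graphs\<close>

record 'a crg =
  VB :: "'a set"
  VW :: "'a set"
  EB :: "'a set set"
  EW :: "'a set set"
  EG :: "'a set set"

definition crg_verts :: "('a, 'm) crg_scheme \<Rightarrow> 'a set" where
  "crg_verts K = VB K \<union> VW K"

definition is_crg :: "'a crg \<Rightarrow> bool" where
  "is_crg K \<longleftrightarrow>
     finite (crg_verts K) \<and> crg_verts K \<noteq> {} \<and> VB K \<inter> VW K = {} \<and>
     EB K \<union> EW K \<union> EG K = nsets (crg_verts K) 2 \<and>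
     EB K \<inter> EW K = {} \<and> EB K \<inter> EG K = {} \<and> EW K \<inter> EG K = {}"

definition crg_iso :: "'a crg \<Rightarrow> 'b crg \<Rightarrow> bool" where
  "crg_iso K L \<longleftrightarrow>
     (\<exists>f. bij_betw f (crg_verts K) (crg_verts L) \<and>
          f ` VB K = VB L \<and> f ` VW K = VW L \<and>
          (`) f ` EB K = EB L \<and> (`) f ` EW K = EW L \<and> (`) f ` EG K = EG L)"

definition sub_crg :: "'a crg \<Rightarrow> 'a set \<Rightarrow> 'a crg" where
  "sub_crg K U =
     \<lparr>VB = VB K \<inter> U, VW = VW K \<inter> U,
      EB = EB K \<inter> Pow U, EW = EW K \<inter> Pow U, EG = EG K \<inter> Pow U\<rparr>"

text \<open>Since the members of \<^term>\<open>EB K\<close>, \<^term>\<open>EW K\<close>, \<^term>\<open>EG K\<close> have exactly two elements,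
  \<open>{x, y} \<in> EB K\<close> etc. already entails \<open>x \<noteq> y\<close>.\<close>

definition maps_to :: "'a graph \<Rightarrow> 'b crg \<Rightarrow> bool" where
  "maps_to F K \<longleftrightarrow>
     (\<exists>\<phi>. \<phi> ` verts F \<subseteq> crg_verts K \<and>
        (\<forall>u\<in>verts F. \<forall>v\<in>verts F. u \<noteq> v \<longrightarrow>
           (if {u, v} \<in> edges F
            then (\<phi> u = \<phi> v \<and> \<phi> u \<in> VB K) \<or> {\<phi> u, \<phi> v} \<in> EB K \<union> EG K
            else (\<phi> u = \<phi> v \<and> \<phi> u \<in> VW K) \<or> {\<phi> u, \<phi> v} \<in> EW K \<union> EG K)))"

definition family_maps_to :: "'a graph set \<Rightarrow> 'b crg \<Rightarrow> bool" where
  "family_maps_to \<F> K \<longleftrightarrow> (\<exists>F\<in>\<F>. maps_to F K)"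


section \<open>The function \<open>g\<close> and cores\<close>

definition crg_matrix :: "'a crg \<Rightarrow> real \<Rightarrow> 'a \<Rightarrow> 'a \<Rightarrow> real" where
  "crg_matrix K p x y =
     (if (x = y \<and> x \<in> VW K) \<or> {x, y} \<in> EW K then p
      else if (x = y \<and> x \<in> VB K) \<or> {x, y} \<in> EB K then 1 - p
      else 0)"

definition prob_masses :: "'a set \<Rightarrow> ('a \<Rightarrow> real) set" where
  "prob_masses V = {\<mu>. (\<forall>x\<in>V. 0 \<le> \<mu> x) \<and> (\<forall>x. x \<notin> V \<longrightarrow> \<mu> x = 0) \<and> (\<Sum>x\<in>V. \<mu> x) = 1}"

definition crg_form :: "'a crg \<Rightarrow> real \<Rightarrow> ('a \<Rightarrow> real) \<Rightarrow> real" where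
  "crg_form K p \<mu> =
     (\<Sum>x\<in>crg_verts K. \<mu> x * (\<Sum>y\<in>crg_verts K. crg_matrix K p x y * \<mu> y))"

text \<open>The infimum is a minimum, as shown in \<open>g_crg_attained\<close> and \<open>g_crg_le\<close> below.\<close>

definition g_crg :: "'a crg \<Rightarrow> real \<Rightarrow> real" where
  "g_crg K p = (INF \<mu>\<in>prob_masses (crg_verts K). crg_form K p \<mu>)"

lemma compact_prob_masses:
  assumes "finite V"
  shows "compact (prob_masses V)"
proof -
  define B where "B = (\<lambda>x. if x \<in> V then {0..1} else {0::real})"
  have "compact (Pi\<^sub>E UNIV B)"
  proof -
    have "compactin (product_topology (\<lambda>_. euclidean) UNIV) (Pi\<^sub>E UNIV B)"
      by (subst compactin_PiE) (auto simp: B_def)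
    then show ?thesis
      by (simp add: euclidean_product_topology)
  qed
  moreover have "closed {\<mu> :: 'a \<Rightarrow> real. (\<Sum>x\<in>V. \<mu> x) = 1}"
    by (intro closed_Collect_eq continuous_on_sum continuous_on_product_coordinates
        continuous_on_const)
  moreover have "prob_masses V = Pi\<^sub>E UNIV B \<inter> {\<mu>. (\<Sum>x\<in>V. \<mu> x) = 1}"
  proof -
    have "\<mu> x \<le> 1" if "\<forall>x\<in>V. 0 \<le> \<mu> x" "(\<Sum>x\<in>V. \<mu> x) = 1" "x \<in> V" for \<mu> :: "'a \<Rightarrow> real" and x
      using member_le_sum[of x V \<mu>] that assms by auto
    then show ?thesis
      by (auto simp: prob_masses_def B_def PiE_iff split: if_splits)
  qed
  ultimately show ?thesis
    by (simp add: compact_Int_closed)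
qed

lemma crg_form_min_exists:
  assumes "is_crg K"
  shows "\<exists>\<mu>\<in>prob_masses (crg_verts K).
           \<forall>\<nu>\<in>prob_masses (crg_verts K). crg_form K p \<mu> \<le> crg_form K p \<nu>"
proof (rule continuous_attains_inf)
  show "compact (prob_masses (crg_verts K))"
    using assms by (simp add: compact_prob_masses is_crg_def)
  obtain x where x: "x \<in> crg_verts K" and fin: "finite (crg_verts K)"
    using assms by (auto simp: is_crg_def)
  then have "(\<lambda>y. if y = x then 1 else 0) \<in> prob_masses (crg_verts K)"
    by (auto simp: prob_masses_def)
  then show "prob_masses (crg_verts K) \<noteq> {}"
    by blast
  show "continuous_on (prob_masses (crg_verts K)) (crg_form K p)"
    unfolding crg_form_def
    by (intro continuous_intros continuous_on_subset[OF continuous_on_product_coordinates]) auto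
qed

lemma g_crg_attained:
  assumes "is_crg K"
  shows "\<exists>\<mu>\<in>prob_masses (crg_verts K). g_crg K p = crg_form K p \<mu>"
proof -
  obtain \<mu> where \<mu>: "\<mu> \<in> prob_masses (crg_verts K)"
    "\<forall>\<nu>\<in>prob_masses (crg_verts K). crg_form K p \<mu> \<le> crg_form K p \<nu>"
    using crg_form_min_exists[OF assms] by blast
  have "g_crg K p = crg_form K p \<mu>"
    unfolding g_crg_def using \<mu> by (intro cInf_eq_minimum) auto
  with \<mu>(1) show ?thesis by blast
qed

lemma g_crg_le:
  assumes "is_crg K" "\<mu> \<in> prob_masses (crg_verts K)"
  shows "g_crg K p \<le> crg_form K p \<mu>"
proof -
  have "bdd_below (crg_form K p ` prob_masses (crg_verts K))"
    using crg_form_min_exists[OF assms(1), of p] unfolding bdd_below_def by blast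
  then show ?thesis
    unfolding g_crg_def using assms(2) by (rule cINF_lower)
qed

definition p_core :: "real \<Rightarrow> 'a crg \<Rightarrow> bool" where
  "p_core p K \<longleftrightarrow>
     (if p = 0 then EB K = {} \<and> EW K \<subseteq> nsets (VB K) 2
      else if p = 1 then EW K = {} \<and> EB K \<subseteq> nsets (VW K) 2
      else \<forall>U. U \<noteq> {} \<and> U \<subset> crg_verts K \<longrightarrow> g_crg (sub_crg K U) p > g_crg K p)"

text \<open>The set $\mathcal K_p(\mathcal H)$ (up to the choice of vertex names)
  for $\mathcal H = \mathrm{Forb}(\mathcal F)$.\<close>

definition core_crgs :: "real \<Rightarrow> nat graph set \<Rightarrow> nat crg set" where
  "core_crgs p \<F> = {K. is_crg K \<and> p_core p K \<and> \<not> family_maps_to \<F> K}"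


section \<open>Replacing white vertices by dalmatian CRGs\<close>

definition dalmatian :: "nat \<Rightarrow> 'a crg \<Rightarrow> bool" where
  "dalmatian l D \<longleftrightarrow>
     is_crg D \<and> VW D = {} \<and> card (VB D) = l \<and> EB D = {} \<and> EG D = {}"

text \<open>\<open>dalmatian_blowup K S l\<close> is $K^l(r)$ with \<open>S\<close>, of cardinality \<open>r\<close>, the set of replaced
  white vertices. The vertex \<open>v \<in> S\<close> becomes the dalmatian CRG on \<open>(v, 0), \<dots>, (v, l - 1)\<close>, any
  other vertex \<open>v\<close> becomes \<open>(v, 0)\<close>, and edges between different fibres keep their color.\<close>

definition fibre :: "'a set \<Rightarrow> nat \<Rightarrow> 'a \<Rightarrow> ('a \<times> nat) set" where
  "fibre S l v = {v} \<times> (if v \<in> S then {..<l} else {0})"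

definition lift_edges :: "'a set \<Rightarrow> nat \<Rightarrow> 'a set set \<Rightarrow> ('a \<times> nat) set set" where
  "lift_edges S l E = {{a, b} | a b u v. {u, v} \<in> E \<and> a \<in> fibre S l u \<and> b \<in> fibre S l v}"

definition dalmatian_blowup :: "'a crg \<Rightarrow> 'a set \<Rightarrow> nat \<Rightarrow> ('a \<times> nat) crg" where
  "dalmatian_blowup K S l =
     \<lparr>VB = (\<Union>v\<in>VB K \<union> S. fibre S l v),
      VW = (\<Union>v\<in>VW K - S. fibre S l v),
      EB = lift_edges S l (EB K),
      EW = lift_edges S l (EW K) \<union> (\<Union>v\<in>S. nsets (fibre S l v) 2),
      EG = lift_edges S l (EG K)\<rparr>"

lemma lift_edges_subset_fibre:
  assumes "E \<subseteq> nsets V 2" "e \<in> lift_edges S l E"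
  shows "\<not> e \<subseteq> fibre S l v"
  using assms by (auto simp: lift_edges_def fibre_def nsets_def card_2_iff doubleton_eq_iff)

lemma dalmatian_fibre:
  assumes K: "is_crg K" and S: "S \<subseteq> VW K" "v \<in> S" and l: "1 \<le> l"
  shows "dalmatian l (sub_crg (dalmatian_blowup K S l) (fibre S l v))"
proof -
  let ?B = "dalmatian_blowup K S l" and ?f = "fibre S l v"
  have no: "lift_edges S l E \<inter> Pow ?f = {}" if "E \<subseteq> nsets (crg_verts K) 2" for E
    using lift_edges_subset_fibre[OF that] by blast
  have "EB ?B \<inter> Pow ?f = {}" "EG ?B \<inter> Pow ?f = {}" "lift_edges S l (EW K) \<inter> Pow ?f = {}"
    using K by (auto simp: dalmatian_blowup_def is_crg_def intro!: no)
  moreover have "(\<Union>u\<in>S. nsets (fibre S l u) 2) \<inter> Pow ?f = nsets ?f 2"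
  proof -
    have "u = v" if "e \<in> nsets (fibre S l u) 2" "e \<subseteq> ?f" for u e
      using that by (auto simp: nsets_def fibre_def card_2_iff split: if_splits)
    moreover have "nsets ?f 2 \<subseteq> Pow ?f"
      by (auto simp: nsets_def)
    ultimately show ?thesis
      using S by blast
  qed
  ultimately have E: "EB ?B \<inter> Pow ?f = {}" "EG ?B \<inter> Pow ?f = {}" "EW ?B \<inter> Pow ?f = nsets ?f 2"
    by (auto simp: dalmatian_blowup_def Int_Un_distrib2)
  have V: "VB ?B \<inter> ?f = ?f" "VW ?B \<inter> ?f = {}"
    using S by (auto simp: dalmatian_blowup_def fibre_def split: if_splits)
  have "finite ?f" "?f \<noteq> {}" "card ?f = l"
    using S l by (auto simp: fibre_def lessThan_empty_iff)
  then show ?thesis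
    by (auto simp: dalmatian_def is_crg_def sub_crg_def crg_verts_def E V)
qed

lemma is_crg_dalmatian_blowup:
  assumes K: "is_crg K" and S: "S \<subseteq> VW K" and l: "1 \<le> l"
  shows "is_crg (dalmatian_blowup K S l)"
proof -
  let ?B = "dalmatian_blowup K S l"
  let ?W = "\<Union>v\<in>S. nsets (fibre S l v) 2"
  have V: "crg_verts ?B = (\<Union>v\<in>crg_verts K. fibre S l v)"
    using S by (auto simp: crg_verts_def dalmatian_blowup_def)
  have fin: "finite (fibre S l v)" and ne: "fibre S l v \<noteq> {}" for v
    using l by (auto simp: fibre_def lessThan_empty_iff)
  have fst_fibre: "fst a = v" if "a \<in> fibre S l v" for a v
    using that by (auto simp: fibre_def)
  have img: "fst ` e \<in> E" if "e \<in> lift_edges S l E" for e E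
    using that by (auto simp: lift_edges_def dest!: fst_fibre)
  have two: "card (fst ` e) = 2" if "e \<in> lift_edges S l E" "E \<subseteq> nsets V 2" for e E V
    using img[OF that(1)] that(2) by (auto simp: nsets_def)
  have one: "card (fst ` e) = 1" if e: "e \<in> ?W" for e
  proof -
    obtain v where "e \<subseteq> fibre S l v" "card e = 2"
      using e by (auto simp: nsets_def)
    then have "fst ` e = {v}"
      by (force simp: fibre_def card_2_iff)
    then show ?thesis by simp
  qed
  have disj: "lift_edges S l E \<inter> lift_edges S l E' = {}" if "E \<inter> E' = {}" for E E'
    using img that by blast
  have disjW: "lift_edges S l E \<inter> ?W = {}" if "E \<subseteq> nsets (crg_verts K) 2" for E
    using one two[OF _ that] by fastforce
  have lift_sub: "lift_edges S l E \<subseteq> nsets (crg_verts ?B) 2" if E: "E \<subseteq> nsets (crg_verts K) 2" for E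
  proof
    fix e assume "e \<in> lift_edges S l E"
    then obtain a b u v where e: "e = {a, b}" "{u, v} \<in> E" "a \<in> fibre S l u" "b \<in> fibre S l v"
      by (auto simp: lift_edges_def)
    then have "u \<noteq> v" "u \<in> crg_verts K" "v \<in> crg_verts K"
      using E by (auto simp: nsets_def card_2_iff doubleton_eq_iff)
    then show "e \<in> nsets (crg_verts ?B) 2"
      using e fst_fibre[OF e(3)] fst_fibre[OF e(4)] unfolding V
      by (auto simp: nsets_def card_insert_if)
  qed
  have EK: "EB K \<subseteq> nsets (crg_verts K) 2" "EW K \<subseteq> nsets (crg_verts K) 2"
    "EG K \<subseteq> nsets (crg_verts K) 2" "EB K \<union> EW K \<union> EG K = nsets (crg_verts K) 2"
    "EB K \<inter> EW K = {}" "EB K \<inter> EG K = {}" "EW K \<inter> EG K = {}"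
    using K by (auto simp: is_crg_def)
  have W_sub: "?W \<subseteq> nsets (crg_verts ?B) 2"
    using S unfolding V by (auto simp: nsets_def crg_verts_def)
  have cover: "e \<in> lift_edges S l (EB K) \<union> lift_edges S l (EW K) \<union> lift_edges S l (EG K) \<union> ?W"
    if e: "e \<in> nsets (crg_verts ?B) 2" for e
  proof -
    obtain a b where ab: "e = {a, b}" "a \<noteq> b"
      using e by (auto simp: nsets_def card_2_iff)
    obtain u v where uv: "u \<in> crg_verts K" "v \<in> crg_verts K" "a \<in> fibre S l u" "b \<in> fibre S l v"
      using e unfolding V ab by (auto simp: nsets_def)
    show ?thesis
    proof (cases "u = v")
      case True
      then have "v \<in> S"
        using uv ab by (auto simp: fibre_def split: if_splits)
      then show ?thesis
        using uv ab True by (auto simp: nsets_def)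
    next
      case False
      then have "{u, v} \<in> EB K \<union> EW K \<union> EG K"
        using uv EK(4) by (auto simp: nsets_def)
      then show ?thesis
        using uv ab unfolding lift_edges_def by blast
    qed
  qed
  have "VB ?B \<inter> VW ?B = {}"
    using K S by (auto simp: dalmatian_blowup_def is_crg_def dest!: fst_fibre)
  moreover have "finite (crg_verts ?B)" "crg_verts ?B \<noteq> {}"
    using K fin ne unfolding V by (auto simp: is_crg_def)
  moreover have "EB ?B \<union> EW ?B \<union> EG ?B = nsets (crg_verts ?B) 2"
    using cover lift_sub[OF EK(1)] lift_sub[OF EK(2)] lift_sub[OF EK(3)] W_sub
    by (simp add: dalmatian_blowup_def) blast
  moreover have "EB ?B \<inter> EW ?B = {}" "EB ?B \<inter> EG ?B = {}" "EW ?B \<inter> EG ?B = {}"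
    using disj[OF EK(5)] disj[OF EK(6)] disj[OF EK(7)] disjW[OF EK(1)] disjW[OF EK(3)]
    by (auto simp: dalmatian_blowup_def)
  ultimately show ?thesis
    by (simp add: is_crg_def)
qed

end

theory Submission
  imports Defs
begin

text \<open>
  Let \<open>\<Gamma>\<close> be a core CRG at a density \<open>q\<close> with \<open>0 < q < 1/2\<close>, let \<open>M\<close> be its matrix, \<open>\<mu>\<close> its optimal
  mass and \<open>g\<close> its value. All vertices have positive mass, the potential \<open>M \<mu>\<close> is constantly \<open>g\<close>, and
  the quadratic form is positive definite on vectors of total mass zero (\<open>p_core_optimum\<close>). These
  facts imply that \<open>\<Gamma>\<close> is 0-core (\<open>p_core_imp_zero_core\<close>).
  Positive definiteness also restricts the white graph on the black vertices, in the way in which a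
  lower bound on the least eigenvalue restricts a graph: up to a bounded number of exceptions, a
  black vertex is joined to a white clique either by white edges only or by gray edges only
  (\<open>few_gray_or_few_white\<close>).

  Suppose that \<open>\<Gamma>\<close> is large. A gray clique of black vertices receives every graph of its order, so
  Ramsey's theorem yields a huge white clique of black vertices. By the dichotomy most of its
  vertices have nearly the same closed white neighbourhood, and since the potential is \<open>g\<close>, this neighbourhood
  has mass at most about \<open>g / q\<close>. For a subclique of size \<open>l\<close>, remove the union \<open>R\<close> of the
  neighbourhoods and give its mass to a new white vertex with gray edges only. This raises the value
  by at most \<open>\<mu> R * (q * \<mu> R - g)\<close>, which is negligible (\<open>g_merge_white_le\<close>). All edges from the
  subclique to the remaining vertices are gray, so the new vertex may be replaced by a dalmatian of
  size \<open>l\<close> without receiving a graph that \<open>\<Gamma>\<close> does not receive (\<open>blowup_merge_white_hom\<close>).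

  Pairwise non-isomorphic CRGs have unbounded order, so the construction applies to the sequence,
  and it can be repeated as long as the orders of the resulting CRGs are unbounded. Replaceable white
  vertices are joined by gray edges, so there are fewer of them than vertices in any member of the
  family. Hence the orders become bounded after a positive number of rounds
  (\<open>bounded_approximants_exist\<close>). Then, up to isomorphism, one CRG occurs for errors tending to zero
  and for dalmatians of all sizes (\<open>bounded_approximants_limit\<close>). The CRG sought is a core
  of it at density \<open>p\<close>. Passing to a core never loses a white vertex, because all edges at a white
  vertex are gray and so every optimal mass is positive there (\<open>core_sub_crg_exists\<close>).
\<close>

section \<open>Color-preserving maps and dalmatian blow-ups\<close>

definition crg_hom :: "('a \<Rightarrow> 'b) \<Rightarrow> 'a crg \<Rightarrow> 'b crg \<Rightarrow> bool" where
  "crg_hom h K L \<longleftrightarrow>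
     h ` VB K \<subseteq> VB L \<and> h ` VW K \<subseteq> VW L \<and>
     (\<forall>x y. {x, y} \<in> EB K \<longrightarrow> {h x, h y} \<in> EB L) \<and>
     (\<forall>x y. {x, y} \<in> EW K \<longrightarrow> {h x, h y} \<in> EW L) \<and>
     (\<forall>x y. {x, y} \<in> EG K \<longrightarrow> {h x, h y} \<in> EG L)"

lemma maps_toI:
  assumes "\<And>u. u \<in> verts F \<Longrightarrow> \<phi> u \<in> crg_verts K"
    and "\<And>u v. \<lbrakk>u \<in> verts F; v \<in> verts F; u \<noteq> v\<rbrakk> \<Longrightarrow>
       (if {u, v} \<in> edges F
        then (\<phi> u = \<phi> v \<and> \<phi> u \<in> VB K) \<or> {\<phi> u, \<phi> v} \<in> EB K \<union> EG K
        else (\<phi> u = \<phi> v \<and> \<phi> u \<in> VW K) \<or> {\<phi> u, \<phi> v} \<in> EW K \<union> EG K)"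
  shows "maps_to F K"
  unfolding maps_to_def using assms by blast

lemma maps_toE:
  assumes "maps_to F K"
  obtains \<phi> where "\<And>u. u \<in> verts F \<Longrightarrow> \<phi> u \<in> crg_verts K"
    and "\<And>u v. \<lbrakk>u \<in> verts F; v \<in> verts F; u \<noteq> v\<rbrakk> \<Longrightarrow>
       (if {u, v} \<in> edges F
        then (\<phi> u = \<phi> v \<and> \<phi> u \<in> VB K) \<or> {\<phi> u, \<phi> v} \<in> EB K \<union> EG K
        else (\<phi> u = \<phi> v \<and> \<phi> u \<in> VW K) \<or> {\<phi> u, \<phi> v} \<in> EW K \<union> EG K)"
proof -
  from assms[unfolded maps_to_def] obtain \<phi> where \<phi>: "\<phi> ` verts F \<subseteq> crg_verts K"
    "\<forall>u\<in>verts F. \<forall>v\<in>verts F. u \<noteq> v \<longrightarrow>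
       (if {u, v} \<in> edges F
        then (\<phi> u = \<phi> v \<and> \<phi> u \<in> VB K) \<or> {\<phi> u, \<phi> v} \<in> EB K \<union> EG K
        else (\<phi> u = \<phi> v \<and> \<phi> u \<in> VW K) \<or> {\<phi> u, \<phi> v} \<in> EW K \<union> EG K)"
    by (elim exE conjE)
  show thesis
    by (rule that[of \<phi>], use \<phi>(1) in blast, rule \<phi>(2)[rule_format])
qed

lemma maps_to_hom:
  assumes "crg_hom h K L" "maps_to F K"
  shows "maps_to F L"
proof -
  obtain \<phi> where \<phi>: "\<And>u. u \<in> verts F \<Longrightarrow> \<phi> u \<in> crg_verts K"
    "\<And>u v. \<lbrakk>u \<in> verts F; v \<in> verts F; u \<noteq> v\<rbrakk> \<Longrightarrow>
       (if {u, v} \<in> edges F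
        then (\<phi> u = \<phi> v \<and> \<phi> u \<in> VB K) \<or> {\<phi> u, \<phi> v} \<in> EB K \<union> EG K
        else (\<phi> u = \<phi> v \<and> \<phi> u \<in> VW K) \<or> {\<phi> u, \<phi> v} \<in> EW K \<union> EG K)"
    by (rule maps_toE[OF assms(2)]) (rule that)
  have "(if {u, v} \<in> edges F
        then (h (\<phi> u) = h (\<phi> v) \<and> h (\<phi> u) \<in> VB L) \<or> {h (\<phi> u), h (\<phi> v)} \<in> EB L \<union> EG L
        else (h (\<phi> u) = h (\<phi> v) \<and> h (\<phi> u) \<in> VW L) \<or> {h (\<phi> u), h (\<phi> v)} \<in> EW L \<union> EG L)"
    if "u \<in> verts F" "v \<in> verts F" "u \<noteq> v" for u v
    using \<phi>(2)[OF that] assms(1) unfolding crg_hom_def by (auto split: if_splits)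
  moreover have "h (\<phi> u) \<in> crg_verts L" if "u \<in> verts F" for u
    using \<phi>(1) assms(1) that unfolding crg_hom_def crg_verts_def by blast
  ultimately show ?thesis
    by (intro maps_toI[of _ "\<lambda>u. h (\<phi> u)"])
qed

lemma family_maps_to_hom:
  "crg_hom h K L \<Longrightarrow> family_maps_to \<F> K \<Longrightarrow> family_maps_to \<F> L"
  unfolding family_maps_to_def by (meson maps_to_hom)

lemma is_crg_doubleton:
  assumes "is_crg K" "{x, y} \<in> EB K \<union> EW K \<union> EG K"
  shows "x \<in> crg_verts K" "y \<in> crg_verts K" "x \<noteq> y"
  using assms doubleton_in_nsets_2[of x y "crg_verts K"] unfolding is_crg_def by auto

lemma mem_fibre:
  "a \<in> fibre S l v \<longleftrightarrow> fst a = v \<and> (if v \<in> S then snd a < l else snd a = 0)"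
  by (cases a) (auto simp: fibre_def)

lemma lift_edges_iff:
  "{a, b} \<in> lift_edges S l E \<longleftrightarrow>
     {fst a, fst b} \<in> E \<and> a \<in> fibre S l (fst a) \<and> b \<in> fibre S l (fst b)"
  (is "?L = ?R")
proof
  assume ?L
  then obtain a' b' u v where e: "{a, b} = {a', b'}" "{u, v} \<in> E" "a' \<in> fibre S l u" "b' \<in> fibre S l v"
    unfolding lift_edges_def by blast
  then have "u = fst a'" "v = fst b'" by (auto simp: mem_fibre)
  with e show ?R by (auto simp: doubleton_eq_iff insert_commute)
next
  assume ?R
  then show ?L unfolding lift_edges_def by blast
qed

lemma blowup_simps:
  "a \<in> VB (dalmatian_blowup K S l) \<longleftrightarrow> fst a \<in> VB K \<union> S \<and> a \<in> fibre S l (fst a)"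
  "a \<in> VW (dalmatian_blowup K S l) \<longleftrightarrow> fst a \<in> VW K - S \<and> a \<in> fibre S l (fst a)"
  "{a, b} \<in> EB (dalmatian_blowup K S l) \<longleftrightarrow>
     {fst a, fst b} \<in> EB K \<and> a \<in> fibre S l (fst a) \<and> b \<in> fibre S l (fst b)"
  "{a, b} \<in> EG (dalmatian_blowup K S l) \<longleftrightarrow>
     {fst a, fst b} \<in> EG K \<and> a \<in> fibre S l (fst a) \<and> b \<in> fibre S l (fst b)"
  "{a, b} \<in> EW (dalmatian_blowup K S l) \<longleftrightarrow>
     a \<in> fibre S l (fst a) \<and> b \<in> fibre S l (fst b) \<and>
     ({fst a, fst b} \<in> EW K \<or> (a \<noteq> b \<and> fst a = fst b \<and> fst a \<in> S))"
  by (auto simp: dalmatian_blowup_def lift_edges_iff) (auto simp: mem_fibre nsets_def)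

lemma blowup_verts:
  assumes "S \<subseteq> VW K"
  shows "a \<in> crg_verts (dalmatian_blowup K S l) \<longleftrightarrow>
     fst a \<in> crg_verts K \<and> a \<in> fibre S l (fst a)"
  using assms by (auto simp: crg_verts_def blowup_simps)

text \<open>A blow-up along the empty set only renames vertices. With the two homomorphisms below, a
  CRG itself is covered by every statement about its blow-ups.\<close>

lemma crg_hom_blowup_empty: "crg_hom (\<lambda>x. (x, 0)) K (dalmatian_blowup K {} l)"
  by (auto simp: crg_hom_def blowup_simps mem_fibre)

lemma crg_hom_unblow_empty: "crg_hom fst (dalmatian_blowup K {} l) K"
  by (auto simp: crg_hom_def blowup_simps mem_fibre)

lemma crg_hom_blowup_mono:
  assumes "l \<le> m"
  shows "crg_hom id (dalmatian_blowup K S l) (dalmatian_blowup K S m)"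
  using assms by (auto simp: crg_hom_def blowup_simps mem_fibre split: if_splits)

lemma crg_hom_blowup_sub:
  "crg_hom id (dalmatian_blowup (sub_crg K U) S l) (dalmatian_blowup K S l)"
  by (auto simp: crg_hom_def blowup_simps mem_fibre sub_crg_def split: if_splits)

text \<open>A graph that maps to a blow-up still maps after enlarging the set of replaced
  vertices, provided the dalmatians are large: the vertices of the graph that are sent to a newly
  replaced white vertex form an independent set, and they can be sent to pairwise distinct
  vertices of the dalmatian. All white vertices of a 0-core CRG are twins, so only the
  cardinalities of the two sets matter.\<close>

lemma maps_to_blowup_card_mono:
  assumes K: "is_crg K" and core: "p_core 0 K"
    and S: "S \<subseteq> VW K" "T \<subseteq> VW K" "card S \<le> card T"
    and F: "finite (verts F)" and m: "maps_to F (dalmatian_blowup K S l)"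
  shows "maps_to F (dalmatian_blowup K T (l + card (verts F) + 1))"
proof -
  let ?L = "l + card (verts F) + 1"
  have EBW: "EB K = {}" "EW K \<subseteq> nsets (VB K) 2"
    using core by (auto simp: p_core_def)
  have fin: "finite (VW K)" and disj: "VB K \<inter> VW K = {}"
    using K by (auto simp: is_crg_def crg_verts_def)
  have finS: "finite S" "finite T" using S fin finite_subset by auto
  obtain T1 where T1: "T1 \<subseteq> T" "card T1 = card S"
    using S(3) obtain_subset_with_card_n by metis
  have finT1: "finite T1" using T1 finS finite_subset by auto
  obtain f where f: "bij_betw f S T1"
    using finite_same_card_bij[OF finS(1) finT1] T1 by auto
  have "card (VW K - S) = card (VW K - T1)"
    using S T1 finS finT1 by (simp add: card_Diff_subset subset_trans[OF T1(1) S(2)])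
  then obtain f' where f': "bij_betw f' (VW K - S) (VW K - T1)"
    using finite_same_card_bij fin by (metis finite_Diff)
  \<comment> \<open>A color-preserving permutation of the vertices that moves \<open>S\<close> into \<open>T\<close>.\<close>
  define \<sigma> where "\<sigma> = (\<lambda>v. if v \<in> S then f v else if v \<in> VW K then f' v else v)"
  have \<sigma>S: "\<sigma> v \<in> T" if "v \<in> S" for v
    using that f T1 by (auto simp: \<sigma>_def bij_betw_def)
  have \<sigma>W: "\<sigma> v \<in> VW K" if "v \<in> VW K" for v
    using that f f' S T1 by (auto simp: \<sigma>_def bij_betw_def)
  have \<sigma>B: "\<sigma> v = v" if "v \<in> VB K" for v
    using that disj S by (auto simp: \<sigma>_def)
  have \<sigma>inj: "inj_on \<sigma> (crg_verts K)"
  proof -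
    have eq: "\<sigma> v = f v" if "v \<in> S" for v using that by (simp add: \<sigma>_def)
    have eq': "\<sigma> v = f' v" if "v \<in> VW K - S" for v using that by (simp add: \<sigma>_def)
    have "bij_betw \<sigma> S T1" by (rule bij_betw_cong[THEN iffD2, OF eq f])
    moreover have "bij_betw \<sigma> (VW K - S) (VW K - T1)"
      by (rule bij_betw_cong[THEN iffD2, OF eq' f'])
    ultimately have "bij_betw \<sigma> (S \<union> (VW K - S)) (T1 \<union> (VW K - T1))"
      by (rule bij_betw_combine) blast
    then have "bij_betw \<sigma> (VW K) (VW K)"
      using S T1 by (simp add: Un_absorb1 subset_trans[OF T1(1) S(2)])
    moreover have "bij_betw \<sigma> (VB K) (VB K)"
      using \<sigma>B bij_betw_id[of "VB K"] by (simp add: bij_betw_def inj_on_def)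
    ultimately have "bij_betw \<sigma> (VW K \<union> VB K) (VW K \<union> VB K)"
      using disj by (intro bij_betw_combine) auto
    then show ?thesis by (simp add: bij_betw_def crg_verts_def Un_commute)
  qed
  have gray: "{\<sigma> x, \<sigma> y} \<in> EG K" if "{x, y} \<in> EG K" for x y
  proof (cases "x \<in> VB K \<and> y \<in> VB K")
    case True
    then show ?thesis using that \<sigma>B by simp
  next
    case False
    have xy: "x \<in> crg_verts K" "y \<in> crg_verts K" "x \<noteq> y"
      using is_crg_doubleton[OF K, of x y] that by auto
    then have "\<sigma> x \<noteq> \<sigma> y" using \<sigma>inj by (auto simp: inj_on_def)
    moreover have "\<sigma> x \<in> crg_verts K" "\<sigma> y \<in> crg_verts K"
      using xy \<sigma>W \<sigma>B by (auto simp: crg_verts_def)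
    ultimately have "{\<sigma> x, \<sigma> y} \<in> EB K \<union> EW K \<union> EG K"
      using K by (auto simp: is_crg_def)
    moreover have "\<sigma> x \<notin> VB K \<or> \<sigma> y \<notin> VB K"
      using False xy \<sigma>W disj by (auto simp: crg_verts_def)
    ultimately show ?thesis using EBW by (auto dest: subsetD)
  qed
  have white: "{\<sigma> x, \<sigma> y} \<in> EW K" if "{x, y} \<in> EW K" for x y
  proof -
    have "x \<in> VB K" "y \<in> VB K" using EBW(2) that by (auto dest: subsetD)
    then show ?thesis using \<sigma>B that by simp
  qed
  obtain e where e: "inj_on e (verts F)" "\<And>u. u \<in> verts F \<Longrightarrow> e u < card (verts F)"
    using ex_bij_betw_finite_nat[OF F] by (fastforce simp: bij_betw_def)
  obtain \<phi> where \<phi>: "\<And>u. u \<in> verts F \<Longrightarrow> \<phi> u \<in> crg_verts (dalmatian_blowup K S l)"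
    "\<And>u v. \<lbrakk>u \<in> verts F; v \<in> verts F; u \<noteq> v\<rbrakk> \<Longrightarrow>
       (if {u, v} \<in> edges F
        then (\<phi> u = \<phi> v \<and> \<phi> u \<in> VB (dalmatian_blowup K S l)) \<or>
             {\<phi> u, \<phi> v} \<in> EB (dalmatian_blowup K S l) \<union> EG (dalmatian_blowup K S l)
        else (\<phi> u = \<phi> v \<and> \<phi> u \<in> VW (dalmatian_blowup K S l)) \<or>
             {\<phi> u, \<phi> v} \<in> EW (dalmatian_blowup K S l) \<union> EG (dalmatian_blowup K S l))"
    by (rule maps_toE[OF m]) (rule that)
  define \<psi> where "\<psi> = (\<lambda>u. (\<sigma> (fst (\<phi> u)),
      if fst (\<phi> u) \<in> S then snd (\<phi> u) else if \<sigma> (fst (\<phi> u)) \<in> T then e u else 0))"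
  have fib: "fst (\<phi> u) \<in> crg_verts K" "\<phi> u \<in> fibre S l (fst (\<phi> u))" if "u \<in> verts F" for u
    using \<phi>(1)[OF that] blowup_verts[OF S(1)] by auto
  have fib': "\<psi> u \<in> fibre T ?L (\<sigma> (fst (\<phi> u)))" if "u \<in> verts F" for u
    using fib[OF that] e(2)[OF that] \<sigma>S by (auto simp: \<psi>_def mem_fibre)
  have \<psi>1: "fst (\<psi> u) = \<sigma> (fst (\<phi> u))" for u by (simp add: \<psi>_def)
  have "\<psi> u \<in> crg_verts (dalmatian_blowup K T ?L)" if "u \<in> verts F" for u
  proof -
    have "\<sigma> (fst (\<phi> u)) \<in> crg_verts K"
      using fib(1)[OF that] \<sigma>W \<sigma>B by (auto simp: crg_verts_def)
    then show ?thesis using fib'[OF that] by (simp add: blowup_verts[OF S(2)] \<psi>1)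
  qed
  moreover have "if {u, v} \<in> edges F
        then (\<psi> u = \<psi> v \<and> \<psi> u \<in> VB (dalmatian_blowup K T ?L)) \<or>
             {\<psi> u, \<psi> v} \<in> EB (dalmatian_blowup K T ?L) \<union> EG (dalmatian_blowup K T ?L)
        else (\<psi> u = \<psi> v \<and> \<psi> u \<in> VW (dalmatian_blowup K T ?L)) \<or>
             {\<psi> u, \<psi> v} \<in> EW (dalmatian_blowup K T ?L) \<union> EG (dalmatian_blowup K T ?L)"
    if uv: "u \<in> verts F" "v \<in> verts F" "u \<noteq> v" for u v
  proof -
    note P = \<phi>(2)[OF uv] and fu = fib[OF uv(1)] and fv = fib[OF uv(2)]
      and fu' = fib'[OF uv(1)] and fv' = fib'[OF uv(2)]
    have grayc: "{\<psi> u, \<psi> v} \<in> EG (dalmatian_blowup K T ?L)" if "{fst (\<phi> u), fst (\<phi> v)} \<in> EG K"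
      using gray[OF that] fu' fv' by (simp add: blowup_simps \<psi>1)
    show ?thesis
    proof (cases "{u, v} \<in> edges F")
      case True
      then consider "{fst (\<phi> u), fst (\<phi> v)} \<in> EG K" | "\<phi> u = \<phi> v" "fst (\<phi> u) \<in> VB K \<union> S"
        using P EBW(1) unfolding blowup_simps Un_iff if_P[OF True] by blast
      then show ?thesis
      proof cases
        case 2
        then have "\<psi> u = \<psi> v"
          using S(2) disj \<sigma>B[of "fst (\<phi> v)"] by (auto simp: \<psi>_def)
        moreover have "\<sigma> (fst (\<phi> u)) \<in> VB K \<union> T" using 2 \<sigma>S \<sigma>B by auto
        ultimately show ?thesis using True fu' 2(1) by (simp add: blowup_simps \<psi>1)
      qed (use True grayc in auto)
    next
      case False
      then consider "{fst (\<phi> u), fst (\<phi> v)} \<in> EG K" | "{fst (\<phi> u), fst (\<phi> v)} \<in> EW K"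
        | "\<phi> u \<noteq> \<phi> v" "fst (\<phi> u) = fst (\<phi> v)" "fst (\<phi> u) \<in> S"
        | "\<phi> u = \<phi> v" "fst (\<phi> u) \<in> VW K - S"
        using P unfolding blowup_simps Un_iff if_not_P[OF False] by blast
      then show ?thesis
      proof cases
        case 2
        then show ?thesis using white[OF 2] False fu' fv' by (simp add: blowup_simps \<psi>1)
      next
        case 3
        then have "\<psi> u \<noteq> \<psi> v" by (auto simp: \<psi>_def prod_eq_iff)
        then show ?thesis using 3 \<sigma>S False fu' fv' by (simp add: blowup_simps \<psi>1)
      next
        case 4
        show ?thesis
        proof (cases "\<sigma> (fst (\<phi> u)) \<in> T")
          case True
          have "\<psi> u \<noteq> \<psi> v" using 4 True e(1) uv by (auto simp: \<psi>_def inj_on_def)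
          then show ?thesis using 4 True False fu' fv' by (simp add: blowup_simps \<psi>1)
        next
          case F: False
          then have "\<psi> u = \<psi> v" using 4 by (auto simp: \<psi>_def)
          moreover have "\<sigma> (fst (\<phi> u)) \<in> VW K - T" using F 4 \<sigma>W by auto
          ultimately show ?thesis using False fu' 4(1) by (simp add: blowup_simps \<psi>1)
        qed
      qed (use False grayc in auto)
    qed
  qed
  ultimately show ?thesis
    by (intro maps_toI[of _ \<psi>])
qed

text \<open>A large set of pairwise gray vertices, each black or replaced by a dalmatian, receives every
  graph with at most that many vertices injectively. This is what bounds both the gray cliques of black
  vertices and the number of dalmatians.\<close>

lemma maps_to_gray_clique:
  assumes T: "T \<subseteq> VB K \<union> S" "clique T (EG K)" and S: "S \<subseteq> VW K" and l: "1 \<le> l"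
    and F: "finite (verts F)" "card (verts F) \<le> card T" "finite T"
  shows "maps_to F (dalmatian_blowup K S l)"
proof -
  obtain e where e: "inj_on e (verts F)" "e ` verts F \<subseteq> T"
    using F by (metis card_le_inj)
  have fib: "(x, 0) \<in> fibre S l x" for x using l by (auto simp: mem_fibre)
  have "{(e u, 0), (e v, 0)} \<in> EG (dalmatian_blowup K S l)"
    if "u \<in> verts F" "v \<in> verts F" "u \<noteq> v" for u v
  proof -
    have "e u \<noteq> e v" "e u \<in> T" "e v \<in> T" using that e by (auto simp: inj_on_def)
    then show ?thesis using T(2) fib by (simp add: blowup_simps clique_def)
  qed
  moreover have "(e u, 0) \<in> crg_verts (dalmatian_blowup K S l)" if "u \<in> verts F" for u
  proof -
    have "e u \<in> crg_verts K" using that e T(1) S by (auto simp: crg_verts_def)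
    then show ?thesis using fib by (simp add: blowup_verts[OF S])
  qed
  ultimately show ?thesis
    by (intro maps_toI[of _ "\<lambda>u. (e u, 0)"]) auto
qed

section \<open>Optimal masses of core CRGs\<close>

definition potential :: "'a crg \<Rightarrow> real \<Rightarrow> ('a \<Rightarrow> real) \<Rightarrow> 'a \<Rightarrow> real" where
  "potential K p \<mu> x = (\<Sum>y\<in>crg_verts K. crg_matrix K p x y * \<mu> y)"

lemma crg_form_potential: "crg_form K p \<mu> = (\<Sum>x\<in>crg_verts K. \<mu> x * potential K p \<mu> x)"
  by (simp add: crg_form_def potential_def)

lemma crg_matrix_sym: "crg_matrix K p x y = crg_matrix K p y x"
  by (auto simp: crg_matrix_def insert_commute)

lemma crg_matrix_bounds:
  assumes "0 \<le> p" "p \<le> 1"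
  shows "0 \<le> crg_matrix K p x y" "crg_matrix K p x y \<le> 1"
  using assms by (auto simp: crg_matrix_def)

lemma crg_matrix_zero_core:
  assumes "EB K = {}" "is_crg K"
  shows "crg_matrix K p x x = (if x \<in> VW K then p else if x \<in> VB K then 1 - p else 0)"
    and "x \<noteq> y \<Longrightarrow> crg_matrix K p x y = (if {x, y} \<in> EW K then p else 0)"
  using assms is_crg_doubleton(3)[OF assms(2), of x x] by (auto simp: crg_matrix_def)

lemma potential_swap:
  "(\<Sum>x\<in>crg_verts K. \<mu> x * potential K p \<nu> x) = (\<Sum>x\<in>crg_verts K. \<nu> x * potential K p \<mu> x)"
proof -
  have "(\<Sum>x\<in>crg_verts K. \<mu> x * potential K p \<nu> x)
      = (\<Sum>x\<in>crg_verts K. \<Sum>y\<in>crg_verts K. \<mu> x * (crg_matrix K p x y * \<nu> y))"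
    by (simp add: potential_def sum_distrib_left)
  also have "\<dots> = (\<Sum>y\<in>crg_verts K. \<Sum>x\<in>crg_verts K. \<mu> x * (crg_matrix K p x y * \<nu> y))"
    by (rule sum.swap)
  also have "\<dots> = (\<Sum>y\<in>crg_verts K. \<nu> y * potential K p \<mu> y)"
    by (simp add: potential_def sum_distrib_left crg_matrix_sym[of K p] mult_ac)
  finally show ?thesis .
qed

lemma crg_form_shift:
  "crg_form K p (\<lambda>x. \<mu> x + t * z x) =
     crg_form K p \<mu> + 2 * t * (\<Sum>x\<in>crg_verts K. z x * potential K p \<mu> x) + t\<^sup>2 * crg_form K p z"
proof -
  have "potential K p (\<lambda>x. \<mu> x + t * z x) x = potential K p \<mu> x + t * potential K p z x" for x
    by (simp add: potential_def sum.distrib sum_distrib_left algebra_simps)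
  then have "crg_form K p (\<lambda>x. \<mu> x + t * z x) =
     crg_form K p \<mu> + t * (\<Sum>x\<in>crg_verts K. z x * potential K p \<mu> x)
     + t * (\<Sum>x\<in>crg_verts K. \<mu> x * potential K p z x) + t\<^sup>2 * crg_form K p z"
    by (simp add: crg_form_potential sum.distrib sum_distrib_left algebra_simps power2_eq_square)
  then show ?thesis
    using potential_swap[of \<mu> K p z] by simp
qed

lemma crg_form_bounds:
  assumes "0 \<le> p" "p \<le> 1" "\<mu> \<in> prob_masses (crg_verts K)"
  shows "0 \<le> crg_form K p \<mu>" "crg_form K p \<mu> \<le> 1"
proof -
  have \<mu>: "0 \<le> \<mu> x" if "x \<in> crg_verts K" for x using assms that by (auto simp: prob_masses_def)
  have one: "sum \<mu> (crg_verts K) = 1" using assms by (auto simp: prob_masses_def)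
  have P: "0 \<le> potential K p \<mu> x" "potential K p \<mu> x \<le> 1" for x
  proof -
    show "0 \<le> potential K p \<mu> x"
      unfolding potential_def using \<mu> crg_matrix_bounds[OF assms(1,2)]
      by (intro sum_nonneg mult_nonneg_nonneg) auto
    have "potential K p \<mu> x \<le> sum \<mu> (crg_verts K)"
      unfolding potential_def using \<mu> crg_matrix_bounds[OF assms(1,2)]
      by (intro sum_mono mult_left_le_one_le) auto
    then show "potential K p \<mu> x \<le> 1" using one by simp
  qed
  show "0 \<le> crg_form K p \<mu>"
    unfolding crg_form_potential using \<mu> P by (intro sum_nonneg mult_nonneg_nonneg) auto
  have "crg_form K p \<mu> \<le> sum \<mu> (crg_verts K)"
    unfolding crg_form_potential using \<mu> P by (intro sum_mono mult_right_le_one_le) auto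
  then show "crg_form K p \<mu> \<le> 1" using one by simp
qed

lemma g_crg_bounds:
  assumes "is_crg K" "0 \<le> p" "p \<le> 1"
  shows "0 \<le> g_crg K p" "g_crg K p \<le> 1"
  using g_crg_attained[OF assms(1), of p] crg_form_bounds[OF assms(2,3)] by auto

lemma g_crg_pos:
  assumes K: "is_crg K" and p: "0 < p" "p < 1"
  shows "0 < g_crg K p"
proof -
  obtain \<mu> where \<mu>: "\<mu> \<in> prob_masses (crg_verts K)" "g_crg K p = crg_form K p \<mu>"
    using g_crg_attained[OF K] by blast
  have fin: "finite (crg_verts K)" using K by (simp add: is_crg_def)
  have nn: "0 \<le> \<mu> x" if "x \<in> crg_verts K" for x using \<mu> that by (auto simp: prob_masses_def)
  have "\<exists>x\<in>crg_verts K. \<mu> x \<noteq> 0"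
    using \<mu>(1) by (auto simp: prob_masses_def intro: ccontr)
  then obtain x where x: "x \<in> crg_verts K" "0 < \<mu> x" using nn by force
  have M: "0 \<le> crg_matrix K p a b" for a b using crg_matrix_bounds(1)[of p] p by simp
  have Mx: "0 < crg_matrix K p x x" using x p by (auto simp: crg_matrix_def crg_verts_def)
  have "0 < crg_matrix K p x x * \<mu> x" using Mx x by simp
  also have "\<dots> \<le> potential K p \<mu> x"
    unfolding potential_def using x fin M nn by (intro member_le_sum) auto
  finally have "0 < \<mu> x * potential K p \<mu> x" using x by simp
  also have "\<dots> \<le> crg_form K p \<mu>"
    unfolding crg_form_potential using x fin nn M
    by (intro member_le_sum) (auto simp: potential_def intro!: mult_nonneg_nonneg sum_nonneg)
  finally show ?thesis using \<mu> by simp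
qed

lemma crg_form_Lipschitz:
  assumes K: "is_crg K" and \<mu>: "\<mu> \<in> prob_masses (crg_verts K)"
  shows "crg_form K p \<mu> \<le> crg_form K q \<mu> + \<bar>p - q\<bar>"
proof -
  have nn: "0 \<le> \<mu> x" if "x \<in> crg_verts K" for x using \<mu> that by (auto simp: prob_masses_def)
  have one: "sum \<mu> (crg_verts K) = 1" using \<mu> by (auto simp: prob_masses_def)
  have M: "crg_matrix K p x y \<le> crg_matrix K q x y + \<bar>p - q\<bar>" for x y
    by (auto simp: crg_matrix_def)
  have "potential K p \<mu> x \<le> potential K q \<mu> x + \<bar>p - q\<bar>" for x
  proof -
    have "potential K p \<mu> x \<le> (\<Sum>y\<in>crg_verts K. (crg_matrix K q x y + \<bar>p - q\<bar>) * \<mu> y)"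
      unfolding potential_def using M nn by (intro sum_mono mult_right_mono) auto
    also have "\<dots> = potential K q \<mu> x + \<bar>p - q\<bar> * sum \<mu> (crg_verts K)"
      by (simp add: potential_def algebra_simps sum.distrib sum_distrib_left sum_subtractf)
    finally show ?thesis using one by simp
  qed
  then have "crg_form K p \<mu> \<le> (\<Sum>x\<in>crg_verts K. \<mu> x * (potential K q \<mu> x + \<bar>p - q\<bar>))"
    unfolding crg_form_potential using nn by (intro sum_mono mult_left_mono) auto
  also have "\<dots> = crg_form K q \<mu> + sum \<mu> (crg_verts K) * \<bar>p - q\<bar>"
    unfolding crg_form_potential by (simp add: distrib_left sum.distrib sum_distrib_right)
  finally show ?thesis using one by simp
qed

lemma g_crg_Lipschitz:
  assumes K: "is_crg K"
  shows "g_crg K p \<le> g_crg K q + \<bar>p - q\<bar>"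
proof -
  obtain \<mu> where \<mu>: "\<mu> \<in> prob_masses (crg_verts K)" "g_crg K q = crg_form K q \<mu>"
    using g_crg_attained[OF K] by blast
  show ?thesis
    using g_crg_le[OF K \<mu>(1), of p] crg_form_Lipschitz[OF K \<mu>(1), of p q] \<mu>(2) by linarith
qed

lemma sub_crg_verts: "crg_verts (sub_crg K U) = crg_verts K \<inter> U"
  by (auto simp: crg_verts_def sub_crg_def)

lemma is_crg_sub:
  assumes K: "is_crg K" and U: "U \<noteq> {}" "U \<subseteq> crg_verts K"
  shows "is_crg (sub_crg K U)"
proof -
  have "nsets (crg_verts K) 2 \<inter> Pow U = nsets U 2"
    using U by (auto simp: nsets_def)
  moreover have "nsets (crg_verts K) 2 = EB K \<union> EW K \<union> EG K"
    using K by (auto simp: is_crg_def)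
  ultimately have "EB K \<inter> Pow U \<union> EW K \<inter> Pow U \<union> EG K \<inter> Pow U = nsets U 2"
    by (simp add: Int_Un_distrib2)
  moreover have "crg_verts K \<inter> U = U" using U by auto
  moreover have "finite U" using U K finite_subset by (auto simp: is_crg_def)
  ultimately show ?thesis
    using K U unfolding is_crg_def sub_crg_verts by (auto simp: sub_crg_def)
qed

lemma crg_form_sub:
  assumes fin: "finite (crg_verts K)" and U: "U \<subseteq> crg_verts K" and \<mu>: "\<And>x. x \<notin> U \<Longrightarrow> \<mu> x = 0"
  shows "crg_form (sub_crg K U) p \<mu> = crg_form K p \<mu>"
proof -
  have V: "crg_verts (sub_crg K U) = U" using U by (auto simp: sub_crg_verts)
  have M: "crg_matrix (sub_crg K U) p x y = crg_matrix K p x y" if "x \<in> U" "y \<in> U" for x y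
    using that by (auto simp: crg_matrix_def sub_crg_def)
  have "(\<Sum>y\<in>U. crg_matrix (sub_crg K U) p x y * \<mu> y) = (\<Sum>y\<in>crg_verts K. crg_matrix K p x y * \<mu> y)"
    if "x \<in> U" for x
    using fin U \<mu> M[OF that] by (intro sum.mono_neutral_cong_left) auto
  then show ?thesis
    unfolding crg_form_def V using fin U \<mu> by (intro sum.mono_neutral_cong_left) auto
qed

lemma prob_masses_mono: "\<lbrakk>U \<subseteq> V; finite V; \<mu> \<in> prob_masses U\<rbrakk> \<Longrightarrow> \<mu> \<in> prob_masses V"
proof -
  assume a: "U \<subseteq> V" "finite V" "\<mu> \<in> prob_masses U"
  then have "sum \<mu> V = sum \<mu> U"
    by (intro sum.mono_neutral_right) (auto simp: prob_masses_def)
  with a show ?thesis by (force simp: prob_masses_def)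
qed

lemma g_sub_crg_le:
  assumes K: "is_crg K" and U: "U \<noteq> {}" "U \<subseteq> crg_verts K" and \<mu>: "\<mu> \<in> prob_masses U"
  shows "g_crg (sub_crg K U) p \<le> crg_form K p \<mu>"
proof -
  have "crg_verts (sub_crg K U) = U" using U by (auto simp: sub_crg_verts)
  then have "g_crg (sub_crg K U) p \<le> crg_form (sub_crg K U) p \<mu>"
    using g_crg_le[OF is_crg_sub[OF K U]] \<mu> by simp
  also have "\<dots> = crg_form K p \<mu>"
    using K U \<mu> by (intro crg_form_sub) (auto simp: is_crg_def prob_masses_def)
  finally show ?thesis .
qed

text \<open>A mass that misses a vertex lives on a proper sub-CRG, whose optimum is larger.\<close>

lemma p_core_boundary:
  assumes K: "is_crg K" and p: "0 < p" "p < 1" and core: "p_core p K"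
    and \<nu>: "\<nu> \<in> prob_masses (crg_verts K)" "v \<in> crg_verts K" "\<nu> v = 0"
  shows "g_crg K p < crg_form K p \<nu>"
proof -
  define U where "U = crg_verts K - {v}"
  have fin: "finite (crg_verts K)" using K by (simp add: is_crg_def)
  have sub: "sum \<nu> (crg_verts K) = sum \<nu> U + \<nu> v"
    using fin \<nu> by (simp add: U_def sum.remove)
  have "sum \<nu> U = 1" using sub \<nu> by (simp add: prob_masses_def)
  then have mU: "\<nu> \<in> prob_masses U" and "U \<noteq> {}"
    using \<nu> unfolding prob_masses_def U_def by fastforce+
  have U: "U \<subset> crg_verts K" using \<nu> by (auto simp: U_def)
  have "g_crg K p < g_crg (sub_crg K U) p"
    using core p U \<open>U \<noteq> {}\<close> by (auto simp: p_core_def)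
  also have "\<dots> \<le> crg_form K p \<nu>"
    using g_sub_crg_le[OF K \<open>U \<noteq> {}\<close> _ mU] U by auto
  finally show ?thesis .
qed

lemma quadratic_nonneg_imp_linear_zero:
  fixes c d \<delta> :: real
  assumes \<delta>: "0 < \<delta>" and nn: "\<And>t. \<bar>t\<bar> \<le> \<delta> \<Longrightarrow> 0 \<le> 2 * t * d + t\<^sup>2 * c"
  shows "d = 0"
proof (rule ccontr)
  assume d: "d \<noteq> 0"
  define s where "s = min \<delta> (\<bar>d\<bar> / (\<bar>c\<bar> + 1))"
  have s: "0 < s" "s \<le> \<delta>" using \<delta> d by (auto simp: s_def)
  have "s * \<bar>c\<bar> < 2 * \<bar>d\<bar>"
  proof -
    have "s * \<bar>c\<bar> \<le> s * (\<bar>c\<bar> + 1)" using s by simp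
    also have "\<dots> \<le> \<bar>d\<bar> / (\<bar>c\<bar> + 1) * (\<bar>c\<bar> + 1)"
      by (intro mult_right_mono) (auto simp: s_def)
    also have "\<dots> = \<bar>d\<bar>" by (simp add: add_nonneg_pos less_imp_neq[symmetric])
    finally show ?thesis using d by simp
  qed
  moreover have "s * c \<le> s * \<bar>c\<bar>" using s by (intro mult_left_mono) auto
  ultimately have "s * c < 2 * \<bar>d\<bar>" by linarith
  then have "s * (s * c) < s * (2 * \<bar>d\<bar>)"
    using s by (intro mult_strict_left_mono) auto
  moreover have "0 \<le> 2 * (- sgn d * s) * d + (- sgn d * s)\<^sup>2 * c"
    using s d by (intro nn) (auto simp: abs_mult sgn_if)
  moreover have "2 * (- sgn d * s) * d + (- sgn d * s)\<^sup>2 * c = - s * (2 * \<bar>d\<bar>) + s * (s * c)"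
    using d by (auto simp: sgn_if power2_eq_square algebra_simps)
  ultimately show False by linarith
qed

lemma sum_unit_difference:
  fixes f :: "'a \<Rightarrow> real"
  assumes "finite V" "x \<in> V" "y \<in> V" "x \<noteq> y"
  shows "(\<Sum>v\<in>V. (if v = x then 1 else if v = y then -1 else 0) * f v) = f x - f y"
proof -
  have "(\<Sum>v\<in>V. (if v = x then 1 else if v = y then -1 else 0) * f v) =
      (\<Sum>v\<in>{x, y}. (if v = x then 1 else if v = y then -1 else 0) * f v)"
    using assms by (intro sum.mono_neutral_right) auto
  then show ?thesis using assms by simp
qed

text \<open>For a core CRG the minimum is attained at an interior point of the simplex and nowhere on
  the boundary. The first-order condition at that point says that the potential is constant. The
  form is positive definite in the directions that preserve total mass: otherwise one could walk
  along such a direction to the boundary without increasing the form.\<close>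

lemma p_core_optimum:
  assumes K: "is_crg K" and p: "0 < p" "p < 1" and core: "p_core p K"
  obtains \<mu> where "\<mu> \<in> prob_masses (crg_verts K)" "crg_form K p \<mu> = g_crg K p"
    and "\<And>x. x \<in> crg_verts K \<Longrightarrow> 0 < \<mu> x"
    and "\<And>x. x \<in> crg_verts K \<Longrightarrow> potential K p \<mu> x = g_crg K p"
    and "\<And>z. (\<forall>x. x \<notin> crg_verts K \<longrightarrow> z x = 0) \<and> sum z (crg_verts K) = 0 \<and> (\<exists>x. z x \<noteq> 0)
               \<Longrightarrow> 0 < crg_form K p z"
proof -
  let ?V = "crg_verts K"
  have fin: "finite ?V" using K by (simp add: is_crg_def)
  obtain \<mu> where \<mu>: "\<mu> \<in> prob_masses ?V" "g_crg K p = crg_form K p \<mu>"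
    using g_crg_attained[OF K] by blast
  have one: "sum \<mu> ?V = 1" and out: "\<And>x. x \<notin> ?V \<Longrightarrow> \<mu> x = 0"
    using \<mu> by (auto simp: prob_masses_def)
  have pos: "0 < \<mu> x" if "x \<in> ?V" for x
  proof -
    have "\<mu> x \<noteq> 0" using p_core_boundary[OF K p core \<mu>(1) that] \<mu>(2) by auto
    moreover have "0 \<le> \<mu> x" using \<mu> that by (auto simp: prob_masses_def)
    ultimately show ?thesis by simp
  qed
  have equal: "potential K p \<mu> x = potential K p \<mu> y" if xy: "x \<in> ?V" "y \<in> ?V" "x \<noteq> y" for x y
  proof -
    define z where "z = (\<lambda>v. if v = x then 1 else if v = y then -1 else 0::real)"
    have sz: "(\<Sum>v\<in>?V. z v * f v) = f x - f y" for f
      unfolding z_def using fin xy by (intro sum_unit_difference) auto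
    have "potential K p \<mu> x - potential K p \<mu> y = 0"
    proof (rule quadratic_nonneg_imp_linear_zero)
      show "0 < min (\<mu> x) (\<mu> y)" using pos xy by simp
      fix t :: real assume t: "\<bar>t\<bar> \<le> min (\<mu> x) (\<mu> y)"
      have "(\<lambda>v. \<mu> v + t * z v) \<in> prob_masses ?V"
        using t pos less_imp_le[OF pos] out one xy sz[of "\<lambda>_. t"]
        by (auto simp: prob_masses_def z_def sum.distrib mult.commute)
      then have "g_crg K p \<le> crg_form K p (\<lambda>v. \<mu> v + t * z v)"
        by (rule g_crg_le[OF K])
      then show "0 \<le> 2 * t * (potential K p \<mu> x - potential K p \<mu> y) + t\<^sup>2 * crg_form K p z"
        using \<mu>(2) by (simp add: crg_form_shift sz)
    qed
    then show ?thesis by simp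
  qed
  have pot: "potential K p \<mu> x = g_crg K p" if x: "x \<in> ?V" for x
  proof -
    have "potential K p \<mu> y = potential K p \<mu> x" if "y \<in> ?V" for y
      using equal[OF that x] by (cases "y = x") auto
    then have "crg_form K p \<mu> = (\<Sum>y\<in>?V. \<mu> y * potential K p \<mu> x)"
      unfolding crg_form_potential by (intro sum.cong) auto
    also have "\<dots> = potential K p \<mu> x"
      using one by (simp flip: sum_distrib_right)
    finally show ?thesis using \<mu> by simp
  qed
  have pd: "0 < crg_form K p z"
    if "(\<forall>x. x \<notin> ?V \<longrightarrow> z x = 0) \<and> sum z ?V = 0 \<and> (\<exists>x. z x \<noteq> 0)" for z
  proof (rule ccontr)
    have z: "\<And>x. x \<notin> ?V \<Longrightarrow> z x = 0" "sum z ?V = 0" "\<exists>x. z x \<noteq> 0" using that by auto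
    assume "\<not> 0 < crg_form K p z"
    then have nonpos: "crg_form K p z \<le> 0" by simp
    define N where "N = {x \<in> ?V. z x < 0}"
    have "N \<noteq> {}"
    proof
      assume "N = {}"
      then have "\<And>x. x \<in> ?V \<Longrightarrow> 0 \<le> z x" by (auto simp: N_def not_less)
      then have "\<And>x. x \<in> ?V \<Longrightarrow> z x = 0" using z(2) fin by (simp add: sum_nonneg_eq_0_iff)
      then show False using z by blast
    qed
    moreover have "finite N" using fin by (simp add: N_def)
    ultimately obtain v where v: "v \<in> N" "\<And>x. x \<in> N \<Longrightarrow> \<mu> v / (- z v) \<le> \<mu> x / (- z x)"
      using arg_min_if_finite[of N "\<lambda>x. \<mu> x / (- z x)"] by (meson not_less)
    \<comment> \<open>The first time at which the walk from \<open>\<mu>\<close> in direction \<open>z\<close> meets the boundary.\<close>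
    define t where "t = \<mu> v / (- z v)"
    have v': "v \<in> ?V" "z v < 0" using v by (auto simp: N_def)
    have t: "0 < t" using v' pos by (simp add: t_def divide_pos_neg)
    have nn: "0 \<le> \<mu> x + t * z x" if "x \<in> ?V" for x
    proof (cases "z x < 0")
      case True
      then have "t \<le> \<mu> x / (- z x)" using v(2)[of x] that by (simp add: t_def N_def)
      moreover have "0 < - z x" using True by simp
      ultimately have "t * (- z x) \<le> \<mu> x" using pos_le_divide_eq by blast
      then show ?thesis by simp
    next
      case False
      then show ?thesis using pos[OF that] t by simp
    qed
    have "(\<lambda>x. \<mu> x + t * z x) \<in> prob_masses ?V"
      using nn out z one by (auto simp: prob_masses_def sum.distrib simp flip: sum_distrib_left)
    moreover have "\<mu> v + t * z v = 0" using v' by (simp add: t_def)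
    ultimately have "g_crg K p < crg_form K p (\<lambda>x. \<mu> x + t * z x)"
      by (intro p_core_boundary[OF K p core _ v'(1)])
    also have "\<dots> = g_crg K p + 2 * t * (\<Sum>x\<in>?V. z x * g_crg K p) + t\<^sup>2 * crg_form K p z"
      using pot \<mu>(2) by (simp add: crg_form_shift cong: sum.cong)
    also have "\<dots> = g_crg K p + t\<^sup>2 * crg_form K p z"
      using z(2) by (simp flip: sum_distrib_right)
    also have "\<dots> \<le> g_crg K p" using nonpos by (simp add: mult_nonneg_nonpos)
    finally show False by simp
  qed
  show thesis
    using that[of \<mu>] \<mu> pos pot pd by metis
qed

section \<open>Core CRGs below one half\<close>

lemma crg_form_isolated:
  assumes fin: "finite (crg_verts K)" and U: "U \<subseteq> crg_verts K" "x \<in> crg_verts K" "x \<notin> U"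
    and iso: "\<And>y. y \<in> U \<Longrightarrow> crg_matrix K p x y = 0"
    and out: "\<And>y. y \<in> crg_verts K - insert x U \<Longrightarrow> \<nu> y = 0"
  shows "crg_form K p \<nu> =
    (\<Sum>a\<in>U. \<nu> a * (\<Sum>b\<in>U. crg_matrix K p a b * \<nu> b)) + crg_matrix K p x x * (\<nu> x)\<^sup>2"
proof -
  have finU: "finite U" using fin U finite_subset by blast
  have restrict: "(\<Sum>y\<in>crg_verts K. f y * \<nu> y) = f x * \<nu> x + (\<Sum>y\<in>U. f y * \<nu> y)" for f
  proof -
    have "(\<Sum>y\<in>crg_verts K. f y * \<nu> y) = (\<Sum>y\<in>insert x U. f y * \<nu> y)"
      using fin U out by (intro sum.mono_neutral_right) auto
    then show ?thesis using finU U by simp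
  qed
  have px: "potential K p \<nu> x = crg_matrix K p x x * \<nu> x"
    unfolding potential_def using restrict[of "crg_matrix K p x"] iso by simp
  have pU: "potential K p \<nu> a = (\<Sum>b\<in>U. crg_matrix K p a b * \<nu> b)" if "a \<in> U" for a
    unfolding potential_def using restrict[of "crg_matrix K p a"] iso[OF that]
    by (simp add: crg_matrix_sym[of K p a x])
  have "crg_form K p \<nu> = potential K p \<nu> x * \<nu> x + (\<Sum>a\<in>U. potential K p \<nu> a * \<nu> a)"
    unfolding crg_form_potential using restrict[of "potential K p \<nu>"] by (simp add: mult.commute)
  also have "(\<Sum>a\<in>U. potential K p \<nu> a * \<nu> a)
      = (\<Sum>a\<in>U. \<nu> a * (\<Sum>b\<in>U. crg_matrix K p a b * \<nu> b))"
    using pU by (intro sum.cong) auto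
  finally show ?thesis using px by (simp add: power2_eq_square)
qed

lemma form_part_le_potential:
  assumes fin: "finite (crg_verts K)" and p: "0 \<le> p" "p \<le> 1" and U: "U \<subseteq> crg_verts K"
    and nn: "\<And>x. x \<in> crg_verts K \<Longrightarrow> 0 \<le> \<mu> x"
    and pot: "\<And>x. x \<in> crg_verts K \<Longrightarrow> potential K p \<mu> x = g"
  shows "(\<Sum>a\<in>U. \<mu> a * (\<Sum>b\<in>U. crg_matrix K p a b * \<mu> b)) \<le> g * sum \<mu> U"
proof -
  have "(\<Sum>b\<in>U. crg_matrix K p a b * \<mu> b) \<le> g" if "a \<in> U" for a
  proof -
    have "(\<Sum>b\<in>U. crg_matrix K p a b * \<mu> b) \<le> potential K p \<mu> a"
      unfolding potential_def using fin U nn crg_matrix_bounds(1)[OF p]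
      by (intro sum_mono2) (auto intro!: mult_nonneg_nonneg)
    then show ?thesis using pot that U by auto
  qed
  then have "(\<Sum>a\<in>U. \<mu> a * (\<Sum>b\<in>U. crg_matrix K p a b * \<mu> b)) \<le> (\<Sum>a\<in>U. \<mu> a * g)"
    using U nn by (intro sum_mono mult_left_mono) auto
  then show ?thesis by (simp add: sum_distrib_left mult.commute)
qed

text \<open>Black edges are excluded by positive definiteness on the difference of two unit masses. If a
  white vertex had a white edge, then moving the mass of all its white neighbours to it would not
  increase the form, although the neighbours lose all their mass.\<close>

lemma p_core_imp_zero_core:
  assumes K: "is_crg K" and p: "0 < p" "p < 1/2" and core: "p_core p K"
  shows "p_core 0 K"
proof -
  let ?V = "crg_verts K"
  have fin: "finite ?V" using K by (simp add: is_crg_def)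
  have p1: "p < 1" using p by simp
  obtain \<mu> where \<mu>: "\<mu> \<in> prob_masses ?V" "crg_form K p \<mu> = g_crg K p"
    and pos: "\<And>x. x \<in> ?V \<Longrightarrow> 0 < \<mu> x"
    and pot: "\<And>x. x \<in> ?V \<Longrightarrow> potential K p \<mu> x = g_crg K p"
    and pd: "\<And>z. (\<forall>x. x \<notin> ?V \<longrightarrow> z x = 0) \<and> sum z ?V = 0 \<and> (\<exists>x. z x \<noteq> 0) \<Longrightarrow> 0 < crg_form K p z"
    by (rule p_core_optimum[OF K p(1) p1 core]) (rule that)
  have no_black: "EB K = {}"
  proof (rule ccontr)
    assume "EB K \<noteq> {}"
    then obtain e where e: "e \<in> EB K" by blast
    then have "e \<in> nsets ?V 2" using K by (auto simp: is_crg_def)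
    then obtain x y where xy: "e = {x, y}" "x \<in> ?V" "y \<in> ?V" "x \<noteq> y"
      by (auto simp: nsets_2_eq)
    define z where "z = (\<lambda>v. if v = x then 1 else if v = y then -1 else 0::real)"
    have sz: "(\<Sum>v\<in>?V. z v * f v) = f x - f y" for f
      unfolding z_def using fin xy by (intro sum_unit_difference) auto
    have "0 < crg_form K p z"
    proof (intro pd conjI)
      show "\<exists>x. z x \<noteq> 0" by (rule exI[of _ x]) (simp add: z_def)
      show "sum z ?V = 0" using sz[of "\<lambda>_. 1"] by simp
    qed (use xy in \<open>auto simp: z_def\<close>)
    moreover have "potential K p z v = crg_matrix K p v x - crg_matrix K p v y" for v
      using sz[of "crg_matrix K p v"] by (simp add: potential_def mult.commute)
    ultimately have "0 < crg_matrix K p x x + crg_matrix K p y y - 2 * crg_matrix K p x y"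
      using sz[of "potential K p z"] crg_matrix_sym[of K p x y] by (simp add: crg_form_potential)
    moreover have "crg_matrix K p x y = 1 - p"
      using e K xy by (auto simp: crg_matrix_def is_crg_def)
    moreover have "crg_matrix K p v v \<le> 1 - p" for v
      using p by (auto simp: crg_matrix_def)
    ultimately show False
      by (smt (verit))
  qed
  have black_ends: "x \<in> VB K" if xy: "{x, y} \<in> EW K" for x y
  proof (rule ccontr)
    assume "x \<notin> VB K"
    have V: "x \<in> ?V" "y \<in> ?V" "x \<noteq> y" using is_crg_doubleton[OF K, of x y] xy by auto
    then have xW: "x \<in> VW K" using \<open>x \<notin> VB K\<close> by (auto simp: crg_verts_def)
    define R where "R = insert x {v. {x, v} \<in> EW K}"
    define U where "U = ?V - R"
    have RV: "R \<subseteq> ?V" using V is_crg_doubleton[OF K] by (auto simp: R_def)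
    have row: "crg_matrix K p x v = (if v \<in> R then p else 0)" if "v \<in> ?V" for v
      using xW crg_matrix_zero_core(1)[OF no_black K, of p x]
        crg_matrix_zero_core(2)[OF no_black K, of x v p] by (cases "v = x") (auto simp: R_def)
    have "potential K p \<mu> x = (\<Sum>v\<in>?V. if v \<in> R then p * \<mu> v else 0)"
      unfolding potential_def by (intro sum.cong) (auto simp: row)
    also have "\<dots> = (\<Sum>v\<in>R. p * \<mu> v)"
      using fin RV by (simp add: sum.If_cases Int_absorb1)
    finally have pR: "p * sum \<mu> R = g_crg K p"
      using pot[OF V(1)] by (simp add: sum_distrib_left)
    have total: "sum \<mu> U + sum \<mu> R = 1"
      using \<mu> fin RV sum.subset_diff[OF RV fin, of \<mu>] by (simp add: U_def prob_masses_def)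
    define \<nu> where "\<nu> = (\<lambda>v. if v = x then sum \<mu> R else if v \<in> U then \<mu> v else 0)"
    have U: "U \<subseteq> ?V" "x \<notin> U" "finite U" using fin by (auto simp: U_def R_def)
    have "sum \<nu> ?V = sum \<nu> (insert x U)"
      using fin V U by (intro sum.mono_neutral_right) (auto simp: \<nu>_def)
    also have "\<dots> = sum \<mu> R + sum \<nu> U" using U by (simp add: \<nu>_def)
    also have "sum \<nu> U = sum \<mu> U" using U by (intro sum.cong) (auto simp: \<nu>_def)
    finally have "sum \<nu> ?V = 1" using total by simp
    moreover have "0 \<le> sum \<mu> R" using pos RV by (intro sum_nonneg) (auto intro: less_imp_le)
    ultimately have "\<nu> \<in> prob_masses ?V"
      using pos less_imp_le[OF pos] V U by (auto simp: prob_masses_def \<nu>_def)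
    moreover have "\<nu> y = 0" using V xy by (auto simp: \<nu>_def U_def R_def)
    ultimately have "g_crg K p < crg_form K p \<nu>"
      by (intro p_core_boundary[OF K p(1) p1 core _ V(2)])
    also have "crg_form K p \<nu> = (\<Sum>a\<in>U. \<nu> a * (\<Sum>b\<in>U. crg_matrix K p a b * \<nu> b))
        + crg_matrix K p x x * (\<nu> x)\<^sup>2"
      using fin V U row by (intro crg_form_isolated) (auto simp: U_def \<nu>_def)
    also have "(\<Sum>a\<in>U. \<nu> a * (\<Sum>b\<in>U. crg_matrix K p a b * \<nu> b))
        = (\<Sum>a\<in>U. \<mu> a * (\<Sum>b\<in>U. crg_matrix K p a b * \<mu> b))"
      using U by (intro sum.cong arg_cong2[of _ _ _ _ "(*)"]) (auto simp: \<nu>_def)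
    also have "\<dots> \<le> g_crg K p * sum \<mu> U"
      using fin p U(1) less_imp_le[OF pos] pot by (intro form_part_le_potential) auto
    also have "crg_matrix K p x x * (\<nu> x)\<^sup>2 = (p * sum \<mu> R) * sum \<mu> R"
      using row[OF V(1)] by (simp add: R_def \<nu>_def power2_eq_square)
    also have "g_crg K p * sum \<mu> U + (p * sum \<mu> R) * sum \<mu> R = g_crg K p * (sum \<mu> U + sum \<mu> R)"
      unfolding pR by (simp add: distrib_left)
    finally show False using total by simp
  qed
  have "EW K \<subseteq> nsets (VB K) 2"
  proof
    fix e assume e: "e \<in> EW K"
    then have "e \<in> nsets ?V 2" using K by (auto simp: is_crg_def)
    then obtain x y where xy: "e = {x, y}" "x \<noteq> y" by (auto simp: nsets_2_eq)
    then show "e \<in> nsets (VB K) 2"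
      using black_ends[of x y] black_ends[of y x] e by (auto simp: insert_commute)
  qed
  with no_black show ?thesis by (simp add: p_core_def)
qed

text \<open>The white vertices of a 0-core CRG have gray edges only, so every optimal mass puts positive
  weight on each of them: starting from a mass that misses one of them, moving a little mass there
  decreases the form to first order. Hence passing to a core keeps all white vertices.\<close>

lemma core_sub_crg_exists:
  assumes K: "is_crg K" and zero: "p_core 0 K" and p: "0 < p" "p < 1"
  obtains U where "U \<noteq> {}" "U \<subseteq> crg_verts K" "VW K \<subseteq> U" "p_core p (sub_crg K U)"
    "g_crg (sub_crg K U) p \<le> g_crg K p"
proof -
  let ?V = "crg_verts K"
  let ?P = "\<lambda>U. U \<noteq> {} \<and> U \<subseteq> ?V \<and> g_crg (sub_crg K U) p \<le> g_crg K p"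
  have fin: "finite ?V" using K by (simp add: is_crg_def)
  have EBW: "EB K = {}" "EW K \<subseteq> nsets (VB K) 2" "VB K \<inter> VW K = {}"
    using zero K by (auto simp: p_core_def is_crg_def)
  have Veq: "sub_crg K ?V = K"
  proof -
    have "EB K \<union> EW K \<union> EG K \<subseteq> Pow ?V" using K by (auto simp: is_crg_def nsets_def)
    then show ?thesis
      unfolding sub_crg_def crg_verts_def by (intro crg.equality) auto
  qed
  have "?P ?V" using Veq K by (auto simp: is_crg_def)
  then obtain U where U: "?P U" and min: "\<And>U'. ?P U' \<Longrightarrow> card U \<le> card U'"
    using ex_has_least_nat[of ?P ?V card] by metis
  have finU: "finite U" using U fin finite_subset by auto
  have VU: "crg_verts (sub_crg K U) = U" using U by (auto simp: sub_crg_verts)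
  have subsub: "sub_crg (sub_crg K U) U' = sub_crg K U'" if "U' \<subseteq> U" for U'
    using that by (auto simp: sub_crg_def)
  have core: "p_core p (sub_crg K U)"
  proof -
    have "g_crg (sub_crg K U) p < g_crg (sub_crg K U') p" if "U' \<noteq> {}" "U' \<subset> U" for U'
    proof -
      have "card U' < card U" using that finU by (simp add: psubset_card_mono)
      then have "\<not> ?P U'" using min[of U'] by auto
      then show ?thesis using that U by auto
    qed
    then have "g_crg (sub_crg K U) p < g_crg (sub_crg (sub_crg K U) U') p"
      if "U' \<noteq> {}" "U' \<subset> U" for U'
      using that by (simp add: subsub psubset_imp_subset)
    then show ?thesis
      using p unfolding p_core_def VU by auto
  qed
  have "VW K \<subseteq> U"
  proof (rule ccontr)
    assume "\<not> VW K \<subseteq> U"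
    then obtain v where v: "v \<in> VW K" "v \<notin> U" by blast
    have vV: "v \<in> ?V" using v by (auto simp: crg_verts_def)
    obtain \<mu> where \<mu>: "\<mu> \<in> prob_masses U" "g_crg (sub_crg K U) p = crg_form (sub_crg K U) p \<mu>"
      using g_crg_attained[OF is_crg_sub[OF K, of U], of p] U VU by auto
    have \<mu>V: "\<mu> \<in> prob_masses ?V" using prob_masses_mono[OF _ fin \<mu>(1)] U by auto
    have f\<mu>: "crg_form K p \<mu> = g_crg (sub_crg K U) p"
      using \<mu> U fin crg_form_sub[of K U \<mu> p] by (auto simp: prob_masses_def)
    define g where "g = g_crg K p"
    have g: "0 < g" "crg_form K p \<mu> \<le> g" using g_crg_pos[OF K p] f\<mu> U by (auto simp: g_def)
    \<comment> \<open>The minimum point of \<open>(1 - t)\<^sup>2 * g + p * t\<^sup>2\<close>, the form after moving mass \<open>t\<close> to \<open>v\<close>.\<close>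
    define t where "t = g / (g + p)"
    have t: "0 < t" "t < 1" using g p by (auto simp: t_def)
    define \<nu> where "\<nu> = (\<lambda>x. if x = v then t else (1 - t) * \<mu> x)"
    have \<nu>U: "\<nu> x = (1 - t) * \<mu> x" if "x \<in> U" for x using that v by (auto simp: \<nu>_def)
    have \<mu>v: "\<mu> x = 0" if "x \<notin> U" for x using \<mu> that by (auto simp: prob_masses_def)
    have "sum \<nu> ?V = sum \<nu> (insert v U)"
      using fin U vV \<mu>v by (intro sum.mono_neutral_right) (auto simp: \<nu>_def)
    also have "\<dots> = t + sum \<nu> U" using finU v by (simp add: \<nu>_def)
    also have "sum \<nu> U = (1 - t) * sum \<mu> U"
      using \<nu>U by (simp add: sum_distrib_left)
    also have "sum \<mu> U = 1" using \<mu> by (simp add: prob_masses_def)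
    finally have "\<nu> \<in> prob_masses ?V"
      using \<mu>V t vV by (auto simp: prob_masses_def \<nu>_def)
    then have "g \<le> crg_form K p \<nu>" unfolding g_def by (rule g_crg_le[OF K])
    also have row: "crg_matrix K p v x = 0" if "x \<in> U" for x
    proof -
      have "{v, x} \<notin> EW K" using EBW(3) v subsetD[OF EBW(2), of "{v, x}"] by auto
      then show ?thesis using crg_matrix_zero_core(2)[OF EBW(1) K, of v x p] that v by auto
    qed
    have "crg_form K p \<nu> =
       (\<Sum>a\<in>U. \<nu> a * (\<Sum>b\<in>U. crg_matrix K p a b * \<nu> b)) + crg_matrix K p v v * (\<nu> v)\<^sup>2"
      using fin U vV v row \<mu>v by (intro crg_form_isolated) (auto simp: \<nu>_def)
    also have "crg_matrix K p v v * (\<nu> v)\<^sup>2 = p * t\<^sup>2"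
      using crg_matrix_zero_core(1)[OF EBW(1) K] v by (simp add: \<nu>_def)
    also have "(\<Sum>a\<in>U. \<nu> a * (\<Sum>b\<in>U. crg_matrix K p a b * \<nu> b))
        = (1 - t)\<^sup>2 * (\<Sum>a\<in>U. \<mu> a * (\<Sum>b\<in>U. crg_matrix K p a b * \<mu> b))"
      using \<nu>U by (simp add: sum_distrib_left power2_eq_square mult_ac cong: sum.cong)
    also have "(\<Sum>a\<in>U. \<mu> a * (\<Sum>b\<in>U. crg_matrix K p a b * \<mu> b)) = crg_form K p \<mu>"
      using crg_form_isolated[of K U v p \<mu>] fin U vV v row \<mu>v by auto
    also have "(1 - t)\<^sup>2 * crg_form K p \<mu> \<le> (1 - t)\<^sup>2 * g"
      using g by (intro mult_left_mono) auto
    finally have "g \<le> (1 - t)\<^sup>2 * g + p * t\<^sup>2" by simp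
    moreover have "(1 - t)\<^sup>2 * g + p * t\<^sup>2 = g - 2 * t * g + t * (t * (g + p))"
      by (simp add: power2_eq_square algebra_simps)
    moreover have "t * (g + p) = g" using g p by (simp add: t_def)
    ultimately have "t * g \<le> 0" by (simp add: mult.commute)
    then show False using t g by (simp add: mult_le_0_iff)
  qed
  then show thesis using that[of U] U core by blast
qed

section \<open>Merging a white clique into a white vertex\<close>

text \<open>Positive definiteness forbids a vertex with both many gray and many white neighbours in a
  white clique: put mass 1 on the vertex, spread mass \<open>s - 1\<close> over the gray neighbours and \<open>- s\<close>
  over the white ones, where \<open>s = (1 - p) / p\<close>. Up to the diagonal terms on the clique, which
  vanish when both parts are large, the form takes the value \<open>2 * p - 1\<close>.\<close>

lemma few_gray_or_few_white:
  assumes K: "is_crg K" and p: "0 < p" "p < 1/2" and core: "p_core p K"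
    and D: "D \<subseteq> VB K" "clique D (EW K)" and x: "x \<in> VB K" "x \<notin> D"
    and C: "2 * ((1 - p) / p)\<^sup>2 \<le> C"
  shows "real (card {d\<in>D. {x, d} \<notin> EW K}) \<le> C \<or> real (card {d\<in>D. {x, d} \<in> EW K}) \<le> C"
proof (rule ccontr)
  let ?V = "crg_verts K"
  define A where "A = {d\<in>D. {x, d} \<notin> EW K}"
  define W where "W = {d\<in>D. {x, d} \<in> EW K}"
  define s where "s = (1 - p) / p"
  define a where "a = real (card A)"
  define b where "b = real (card W)"
  assume "\<not> ?thesis"
  then have ab: "C < a" "C < b" by (auto simp: A_def W_def a_def b_def)
  have fin: "finite ?V" using K by (simp add: is_crg_def)
  have p1: "p < 1" using p by simp
  have finB: "finite (VB K)" "finite D" using fin D by (auto simp: crg_verts_def finite_subset)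
  have s: "1 \<le> s" "p * s = 1 - p" using p by (auto simp: s_def)
  have "0 < 2 * s\<^sup>2" using s by simp
  moreover have Cs: "2 * s\<^sup>2 \<le> C" using C by (simp only: s_def)
  ultimately have C0: "0 < C" by linarith
  then have ab0: "0 < a" "0 < b" using ab by auto
  have no_black: "EB K = {}" and disj: "VB K \<inter> VW K = {}"
    using p_core_imp_zero_core[OF K p core] K by (auto simp: p_core_def is_crg_def)
  note M = crg_matrix_zero_core[OF no_black K]
  have finAW: "finite A" "finite W" "A \<inter> W = {}" "A \<union> W = D"
    using finB by (auto simp: A_def W_def)
  define z where "z = (\<lambda>v. if v = x then 1 else if v \<in> A then (s - 1) / a
      else if v \<in> W then - s / b else 0)"
  have zA: "z v = (s - 1) / a" if "v \<in> A" for v using that x by (auto simp: z_def A_def)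
  have zW: "z v = - s / b" if "v \<in> W" for v using that x by (auto simp: z_def A_def W_def)
  have split: "(\<Sum>v\<in>D. f v) = (\<Sum>v\<in>A. f v) + (\<Sum>v\<in>W. f v)" for f :: "_ \<Rightarrow> real"
    using sum.union_disjoint[OF finAW(1-3), of f] finAW(4) by simp
  have sA: "(\<Sum>v\<in>A. z v) = s - 1" using ab0 zA by (simp add: a_def)
  have sW: "(\<Sum>v\<in>W. z v) = - s" using ab0 zW by (simp add: b_def)
  have sD: "(\<Sum>v\<in>D. z v) = - 1" using split[of z] sA sW by simp
  have restrict: "(\<Sum>v\<in>?V. f v * z v) = f x + (\<Sum>v\<in>D. f v * z v)" for f
  proof -
    have "(\<Sum>v\<in>?V. f v * z v) = (\<Sum>v\<in>insert x D. f v * z v)"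
      using fin D x finAW by (intro sum.mono_neutral_right) (auto simp: z_def crg_verts_def)
    then show ?thesis using finB x by (simp add: z_def)
  qed
  have "0 < crg_form K p z"
  proof (rule p_core_optimum[OF K p(1) p1 core])
    fix \<mu> assume pd: "\<And>z. (\<forall>x. x \<notin> ?V \<longrightarrow> z x = 0) \<and> sum z ?V = 0 \<and> (\<exists>x. z x \<noteq> 0) \<Longrightarrow> 0 < crg_form K p z"
    have "\<forall>v. v \<notin> ?V \<longrightarrow> z v = 0"
      using D x finAW by (auto simp: z_def crg_verts_def)
    moreover have "sum z ?V = 0" using restrict[of "\<lambda>_. 1"] sD by simp
    moreover have "z x \<noteq> 0" by (simp add: z_def)
    ultimately show ?thesis using pd[of z] by blast
  qed
  moreover have "potential K p z x = (1 - p) - p * s"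
  proof -
    have "potential K p z x = crg_matrix K p x x + (\<Sum>v\<in>D. crg_matrix K p x v * z v)"
      unfolding potential_def by (rule restrict)
    also have "crg_matrix K p x x = 1 - p" using M(1)[of p x] x disj by auto
    also have "(\<Sum>v\<in>D. crg_matrix K p x v * z v) = (\<Sum>v\<in>A. 0) + (\<Sum>v\<in>W. p * z v)"
    proof -
      have "crg_matrix K p x v = (if v \<in> W then p else 0)" if "v \<in> D" for v
        using M(2)[of x v p] that x by (cases "x = v") (auto simp: W_def)
      then have "crg_matrix K p x v = 0" if "v \<in> A" for v
        using that finAW by auto
      moreover have "crg_matrix K p x v = p" if "v \<in> W" for v
        using M(2)[of x v p] that x by (cases "x = v") (auto simp: W_def)
      ultimately show ?thesis unfolding split by simp
    qed
    finally show ?thesis using sW by (simp flip: sum_distrib_left)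
  qed
  moreover have "potential K p z d = (if d \<in> W then p else 0) - p + (1 - 2 * p) * z d"
    if d: "d \<in> D" for d
  proof -
    have row: "crg_matrix K p d v = p + (if v = d then 1 - 2 * p else 0)" if "v \<in> D" for v
    proof (cases "v = d")
      case True
      then show ?thesis using M(1)[of p d] d D disj by auto
    next
      case False
      then have "{d, v} \<in> EW K" using D(2) d that by (auto simp: clique_def)
      then show ?thesis using M(2)[of d v p] False by auto
    qed
    have "potential K p z d = crg_matrix K p d x + (\<Sum>v\<in>D. crg_matrix K p d v * z v)"
      unfolding potential_def by (rule restrict)
    also have "crg_matrix K p d x = (if d \<in> W then p else 0)"
      using M(2)[of d x p] d x by (cases "d = x") (auto simp: W_def insert_commute)
    also have "(\<Sum>v\<in>D. crg_matrix K p d v * z v)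
        = (\<Sum>v\<in>D. p * z v + (if v = d then (1 - 2 * p) * z d else 0))"
      using row by (intro sum.cong) (auto simp: algebra_simps)
    also have "\<dots> = p * (\<Sum>v\<in>D. z v) + (1 - 2 * p) * z d"
      using finB d by (simp add: sum.distrib sum_distrib_left)
    finally show ?thesis using sD by simp
  qed
  moreover have "crg_form K p z = potential K p z x + (\<Sum>d\<in>D. potential K p z d * z d)"
    unfolding crg_form_potential using restrict[of "potential K p z"] by (simp add: mult.commute)
  ultimately have "0 < (1 - p) - p * s
      + (\<Sum>d\<in>D. ((if d \<in> W then p else 0) - p + (1 - 2 * p) * z d) * z d)"
    by (simp cong: sum.cong)
  also have "(\<Sum>d\<in>D. ((if d \<in> W then p else 0) - p + (1 - 2 * p) * z d) * z d)
     = (\<Sum>d\<in>A. - p * z d + (1 - 2 * p) * (z d)\<^sup>2) + (\<Sum>d\<in>W. (1 - 2 * p) * (z d)\<^sup>2)"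
    unfolding split using finAW
    by (intro arg_cong2[of _ _ _ _ "(+)"] sum.cong refl)
      (auto simp: algebra_simps power2_eq_square)
  also have "\<dots> = - p * (s - 1) + (1 - 2 * p) * ((\<Sum>d\<in>A. (z d)\<^sup>2) + (\<Sum>d\<in>W. (z d)\<^sup>2))"
    using sA by (simp add: sum.distrib sum_subtractf distrib_left flip: sum_distrib_left)
  also have "(\<Sum>d\<in>A. (z d)\<^sup>2) = (s - 1)\<^sup>2 / a"
    using zA ab0 by (simp add: a_def power2_eq_square)
  also have "(\<Sum>d\<in>W. (z d)\<^sup>2) = s\<^sup>2 / b"
    using zW ab0 by (simp add: b_def power2_eq_square)
  finally have "0 < (1 - p) - p * s - p * (s - 1) + (1 - 2 * p) * ((s - 1)\<^sup>2 / a + s\<^sup>2 / b)"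
    by simp
  also have "(1 - p) - p * s - p * (s - 1) = - (1 - 2 * p)"
    using s(2) by (simp add: algebra_simps)
  finally have "0 < (1 - 2 * p) * ((s - 1)\<^sup>2 / a + s\<^sup>2 / b - 1)"
    by (simp add: algebra_simps)
  then have "1 < (s - 1)\<^sup>2 / a + s\<^sup>2 / b" using p by (simp add: zero_less_mult_iff)
  moreover have "(s - 1)\<^sup>2 / a \<le> 1 / 2"
  proof -
    have "(s - 1)\<^sup>2 \<le> s\<^sup>2" using s by (intro power_mono) auto
    then show ?thesis using ab ab0 Cs by (simp add: pos_divide_le_eq)
  qed
  moreover have "s\<^sup>2 / b \<le> 1 / 2"
    using ab ab0 Cs by (simp add: pos_divide_le_eq)
  ultimately show False by linarith
qed

definition merge_white :: "'a crg \<Rightarrow> 'a set \<Rightarrow> 'a \<Rightarrow> 'a crg" where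
  "merge_white K R v =
     \<lparr>VB = VB K - R, VW = insert v (VW K), EB = {}, EW = EW K \<inter> Pow (VB K - R),
      EG = nsets (insert v (crg_verts K - R)) 2 - EW K \<inter> Pow (VB K - R)\<rparr>"

lemma merge_white_verts:
  assumes "R \<subseteq> VB K" "is_crg K"
  shows "crg_verts (merge_white K R v) = insert v (crg_verts K - R)"
  using assms by (auto simp: merge_white_def crg_verts_def is_crg_def)

lemma is_crg_merge_white:
  assumes K: "is_crg K" and R: "R \<subseteq> VB K" and v: "v \<notin> crg_verts K"
  shows "is_crg (merge_white K R v)" "p_core 0 (merge_white K R v)"
proof -
  have "EW K \<inter> Pow (VB K - R) \<subseteq> nsets (VB K - R) 2"
    using K by (auto simp: is_crg_def nsets_def)
  moreover have "nsets (VB K - R) 2 \<subseteq> nsets (insert v (crg_verts K - R)) 2"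
    by (intro nsets_mono) (auto simp: crg_verts_def)
  moreover have "VB K \<inter> VW K = {}" "finite (crg_verts K)" using K by (auto simp: is_crg_def)
  ultimately show "is_crg (merge_white K R v)"
    using v unfolding is_crg_def merge_white_verts[OF R K]
    by (auto simp: merge_white_def crg_verts_def)
  show "p_core 0 (merge_white K R v)"
    using K by (auto simp: p_core_def merge_white_def is_crg_def nsets_def)
qed

text \<open>Move all mass of \<open>R\<close> to the new white vertex. The other vertices contribute at most \<open>g\<close> per
  unit of mass, because the matrix is nonnegative and the potential was \<open>g\<close> before the move; the
  new vertex has gray edges only, so it contributes \<open>p\<close> times the square of its mass.\<close>

lemma g_merge_white_le:
  assumes K: "is_crg K" and p: "0 < p" "p < 1/2" and core: "p_core p K"
    and R: "R \<subseteq> VB K" and v: "v \<notin> crg_verts K"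
    and \<mu>: "\<mu> \<in> prob_masses (crg_verts K)"
    and pot: "\<And>x. x \<in> crg_verts K \<Longrightarrow> potential K p \<mu> x = g_crg K p"
  shows "g_crg (merge_white K R v) p
    \<le> g_crg K p + sum \<mu> R * (p * sum \<mu> R - g_crg K p)"
proof -
  let ?V = "crg_verts K" and ?L = "merge_white K R v"
  define U where "U = ?V - R"
  have fin: "finite ?V" using K by (simp add: is_crg_def)
  note L = is_crg_merge_white[OF K R v]
  have VL: "crg_verts ?L = insert v U" using merge_white_verts[OF R K] by (simp add: U_def)
  have RV: "R \<subseteq> ?V" using R by (auto simp: crg_verts_def)
  have zero: "EB K = {}" "EW K \<subseteq> nsets (VB K) 2"
    using p_core_imp_zero_core[OF K p core] by (auto simp: p_core_def)
  have nn: "0 \<le> \<mu> x" if "x \<in> ?V" for x using \<mu> that by (auto simp: prob_masses_def)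
  have total: "sum \<mu> U + sum \<mu> R = 1"
    using \<mu> fin RV sum.subset_diff[OF RV fin, of \<mu>] by (simp add: U_def prob_masses_def)
  have U: "finite U" "v \<notin> U" "U \<subseteq> ?V" using fin v by (auto simp: U_def)
  define \<nu> where "\<nu> = (\<lambda>x. if x = v then sum \<mu> R else if x \<in> U then \<mu> x else 0)"
  have \<nu>U: "\<nu> x = \<mu> x" if "x \<in> U" for x using that U by (auto simp: \<nu>_def)
  have "sum \<nu> (insert v U) = sum \<mu> R + sum \<mu> U"
    using U \<nu>U by (simp add: \<nu>_def)
  moreover have "0 \<le> sum \<mu> R" using nn RV by (intro sum_nonneg) auto
  ultimately have "\<nu> \<in> prob_masses (crg_verts ?L)"
    using total nn U by (auto simp: VL prob_masses_def \<nu>_def)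
  then have "g_crg ?L p \<le> crg_form ?L p \<nu>" by (rule g_crg_le[OF L(1)])
  also have "crg_form ?L p \<nu> = (\<Sum>a\<in>U. \<nu> a * (\<Sum>b\<in>U. crg_matrix ?L p a b * \<nu> b))
      + crg_matrix ?L p v v * (\<nu> v)\<^sup>2"
  proof (intro crg_form_isolated)
    show "crg_matrix ?L p v y = 0" if "y \<in> U" for y
      using that U v by (auto simp: crg_matrix_def merge_white_def crg_verts_def)
  qed (use U in \<open>auto simp: VL\<close>)
  also have "crg_matrix ?L p v v * (\<nu> v)\<^sup>2 = p * sum \<mu> R * sum \<mu> R"
    by (simp add: crg_matrix_def merge_white_def \<nu>_def power2_eq_square)
  also have "(\<Sum>a\<in>U. \<nu> a * (\<Sum>b\<in>U. crg_matrix ?L p a b * \<nu> b))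
      = (\<Sum>a\<in>U. \<mu> a * (\<Sum>b\<in>U. crg_matrix K p a b * \<mu> b))"
  proof -
    have "crg_matrix ?L p a b = crg_matrix K p a b" if "a \<in> U" "b \<in> U" for a b
      using that U zero subsetD[OF zero(2), of "{a, b}"]
      by (auto simp: crg_matrix_def merge_white_def U_def crg_verts_def)
    then show ?thesis using \<nu>U by (simp cong: sum.cong)
  qed
  also have "\<dots> \<le> g_crg K p * sum \<mu> U"
    using fin p U nn pot by (intro form_part_le_potential) auto
  also have "sum \<mu> U = 1 - sum \<mu> R" using total by simp
  finally show ?thesis by (simp add: algebra_simps)
qed

definition white_nbhd :: "'a crg \<Rightarrow> 'a set \<Rightarrow> 'a set" where
  "white_nbhd K D = {x \<in> VB K. \<exists>d\<in>D. x = d \<or> {x, d} \<in> EW K}"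

text \<open>After the closed white neighbourhood of a white clique \<open>D\<close> is removed, all remaining edges
  at \<open>D\<close> are gray, so \<open>D\<close> can serve as the dalmatian that replaces the new white vertex.\<close>

lemma blowup_merge_white_hom:
  assumes K: "is_crg K" and zero: "p_core 0 K" and v: "v \<notin> crg_verts K"
    and D: "D \<subseteq> VB K" "clique D (EW K)" "card D = l" "1 \<le> l" and S: "S \<subseteq> VW K"
  shows "\<exists>h. crg_hom h (dalmatian_blowup (merge_white K (white_nbhd K D) v) (insert v S) l)
    (dalmatian_blowup K S l)"
proof -
  let ?R = "white_nbhd K D"
  have finD: "finite D" using D card.infinite by fastforce
  then obtain e where e: "bij_betw e {0..<l} D"
    using ex_bij_betw_nat_finite D(3) by metis
  have eD: "e i \<in> D" if "i < l" for i using e that by (auto simp: bij_betw_def)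
  have einj: "e i \<noteq> e j" if "i < l" "j < l" "i \<noteq> j" for i j
    using e that by (auto simp: bij_betw_def inj_on_def)
  have disj: "VB K \<inter> VW K = {}" using K by (simp add: is_crg_def)
  have white_black: "x \<in> VB K" if "{x, y} \<in> EW K" for x y
    using zero that by (auto simp: p_core_def dest: subsetD)
  have EB: "EB K = {}" using zero by (simp add: p_core_def)
  have eB: "e i \<in> VB K" "e i \<notin> S" "e i \<noteq> v" if "i < l" for i
    using eD[OF that] D(1) S disj v by (auto simp: crg_verts_def)
  have vS: "v \<notin> S" "v \<notin> VW K" "v \<notin> VB K" using v S by (auto simp: crg_verts_def)
  define h where "h = (\<lambda>(x, i). if x = v then (e i, 0::nat) else (x, i))"
  have gray_old: "{x, y} \<in> EG K"
    if "{x, y} \<in> EG (merge_white K ?R v)" "x \<noteq> v" "y \<noteq> v" for x y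
  proof -
    have xy: "x \<in> crg_verts K - ?R" "y \<in> crg_verts K - ?R" "x \<noteq> y"
      "{x, y} \<notin> EW K \<inter> Pow (VB K - ?R)"
      using that by (auto simp: merge_white_def)
    then have "{x, y} \<notin> EW K" using white_black[of x y] white_black[of y x]
      by (auto simp: insert_commute)
    moreover have "{x, y} \<in> EB K \<union> EW K \<union> EG K" using xy K by (auto simp: is_crg_def)
    ultimately show ?thesis using EB by auto
  qed
  have gray_new: "{e i, y} \<in> EG K"
    if "{v, y} \<in> EG (merge_white K ?R v)" "i < l" for i y
  proof -
    have y: "y \<in> crg_verts K" "y \<notin> ?R" using that(1) by (auto simp: merge_white_def)
    then have "{y, e i} \<notin> EW K" "y \<noteq> e i"
      using white_black[of y "e i"] eD[OF that(2)] eB[OF that(2)] by (auto simp: white_nbhd_def)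
    moreover have "e i \<in> crg_verts K" using eB[OF that(2)] by (auto simp: crg_verts_def)
    ultimately have "{e i, y} \<in> EB K \<union> EW K \<union> EG K" "{e i, y} \<notin> EW K"
      using y K by (auto simp: is_crg_def insert_commute)
    then show ?thesis using EB by auto
  qed
  have "crg_hom h (dalmatian_blowup (merge_white K ?R v) (insert v S) l) (dalmatian_blowup K S l)"
    unfolding crg_hom_def
  proof (intro conjI allI impI)
    show "h ` VB (dalmatian_blowup (merge_white K ?R v) (insert v S) l) \<subseteq> VB (dalmatian_blowup K S l)"
      using eB vS by (auto simp: blowup_simps mem_fibre h_def merge_white_def split: if_splits)
    show "h ` VW (dalmatian_blowup (merge_white K ?R v) (insert v S) l) \<subseteq> VW (dalmatian_blowup K S l)"
      using vS by (auto simp: blowup_simps mem_fibre h_def merge_white_def split: if_splits)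
  next
    fix a b
    assume "{a, b} \<in> EB (dalmatian_blowup (merge_white K ?R v) (insert v S) l)"
    then show "{h a, h b} \<in> EB (dalmatian_blowup K S l)"
      by (simp add: blowup_simps merge_white_def)
  next
    fix a b
    assume ab: "{a, b} \<in> EW (dalmatian_blowup (merge_white K ?R v) (insert v S) l)"
    obtain x i y j where [simp]: "a = (x, i)" "b = (y, j)" by (metis prod.exhaust)
    consider "{x, y} \<in> EW K" "x \<noteq> v" "y \<noteq> v" | "i \<noteq> j" "x = y" "x \<in> S"
      | "i \<noteq> j" "x = v" "y = v" "i < l" "j < l"
      using ab vS by (auto simp: blowup_simps merge_white_def mem_fibre)
    then show "{h a, h b} \<in> EW (dalmatian_blowup K S l)"
    proof cases
      case 3
      then have "{e i, e j} \<in> EW K" using D(2) eD einj by (auto simp: clique_def)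
      then show ?thesis using 3 eB by (simp add: blowup_simps mem_fibre h_def)
    qed (use ab vS in \<open>auto simp: blowup_simps mem_fibre h_def\<close>)
  next
    fix a b
    assume ab: "{a, b} \<in> EG (dalmatian_blowup (merge_white K ?R v) (insert v S) l)"
    obtain x i y j where [simp]: "a = (x, i)" "b = (y, j)" by (metis prod.exhaust)
    have xy: "{x, y} \<in> EG (merge_white K ?R v)" "(x, i) \<in> fibre (insert v S) l x"
      "(y, j) \<in> fibre (insert v S) l y" using ab by (auto simp: blowup_simps)
    then have "x \<noteq> y" by (auto simp: merge_white_def)
    show "{h a, h b} \<in> EG (dalmatian_blowup K S l)"
    proof (cases "x = v")
      case True
      then have "i < l" "y \<noteq> v" using xy \<open>x \<noteq> y\<close> by (auto simp: mem_fibre)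
      then show ?thesis using gray_new[of y i] True xy eB
        by (auto simp: blowup_simps mem_fibre h_def)
    next
      case x: False
      show ?thesis
      proof (cases "y = v")
        case True
        then have "j < l" using xy by (auto simp: mem_fibre)
        moreover have "{v, x} \<in> EG (merge_white K ?R v)" using xy True by (simp add: insert_commute)
        ultimately have "{x, e j} \<in> EG K" using gray_new[of x j] by (simp add: insert_commute)
        then show ?thesis using True x xy eB[OF \<open>j < l\<close>]
          by (auto simp: blowup_simps mem_fibre h_def)
      next
        case False
        then show ?thesis using gray_old[of x y] x xy
          by (auto simp: blowup_simps mem_fibre h_def)
      qed
    qed
  qed
  then show ?thesis by blast
qed

lemma sum_UN_le:
  fixes f :: "'a \<Rightarrow> real"
  assumes "finite I" "\<And>i. i \<in> I \<Longrightarrow> finite (A i)" "\<And>x. 0 \<le> f x"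
  shows "sum f (\<Union>i\<in>I. A i) \<le> (\<Sum>i\<in>I. sum f (A i))"
  using assms(1,2)
proof (induction I rule: finite_induct)
  case (insert i I)
  let ?B = "\<Union>j\<in>I. A j"
  have "sum f (A i \<union> ?B) + sum f (A i \<inter> ?B) = sum f (A i) + sum f ?B"
    using insert by (intro sum.union_inter) auto
  moreover have "0 \<le> sum f (A i \<inter> ?B)" using assms(3) by (intro sum_nonneg) auto
  moreover have "sum f ?B \<le> (\<Sum>i\<in>I. sum f (A i))" using insert by auto
  ultimately show ?case using insert(1,2) by simp
qed simp

text \<open>The closed white neighbourhoods of most vertices of a huge white clique \<open>D\<close> nearly coincide:
  a black vertex is white to almost all of \<open>D\<close> or to almost none of it. Each
  neighbourhood has mass at most \<open>g / p\<close> because the potential is \<open>g\<close>. So the vertices of the first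
  kind have mass at most about \<open>g / p\<close>, and Markov's inequality gives a subclique that sees little mass of the second kind.\<close>

lemma subclique_small_white_nbhd:
  assumes K: "is_crg K" and p: "0 < p" "p < 1/2" and core: "p_core p K"
    and \<mu>: "\<mu> \<in> prob_masses (crg_verts K)"
    and pot: "\<And>x. x \<in> crg_verts K \<Longrightarrow> potential K p \<mu> x = g"
    and D: "D \<subseteq> VB K" "clique D (EW K)" "card D = L"
    and C: "2 * ((1 - p) / p)\<^sup>2 \<le> real C" and L: "C + 1 < L" "2 * l \<le> L"
  obtains D' where "D' \<subseteq> D" "card D' = l"
    "p * sum \<mu> (white_nbhd K D') \<le> g * L / (real L - (real C + 1)) + 2 * real l * real C / real L"
proof -
  have fin: "finite (crg_verts K)" using K by (simp add: is_crg_def)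
  have finB: "finite (VB K)" "finite D" using fin D by (auto simp: crg_verts_def finite_subset)
  have nn: "0 \<le> \<mu> x" for x using \<mu> by (cases "x \<in> crg_verts K") (auto simp: prob_masses_def)
  define Wd where "Wd = (\<lambda>d. {x \<in> VB K. {x, d} \<in> EW K})"
  define Dx where "Dx = (\<lambda>x. {d \<in> D. {x, d} \<in> EW K})"
  define Ax where "Ax = (\<lambda>x. {d \<in> D. {x, d} \<notin> EW K})"
  define X0 where "X0 = {x \<in> VB K. card (Ax x) \<le> C + 1}"
  define X1 where "X1 = VB K - X0"
  have "1 \<le> (1 - p) / p" using p by simp
  then have "1 \<le> ((1 - p) / p)\<^sup>2" by simp
  then have "2 \<le> real C" using C by linarith
  then have C0: "0 < C" by simp
  have Dsplit: "card (Ax x) + card (Dx x) = L" for x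
  proof -
    have "Ax x \<union> Dx x = D" "Ax x \<inter> Dx x = {}" by (auto simp: Ax_def Dx_def)
    then show ?thesis using card_Un_disjoint[of "Ax x" "Dx x"] finB D(3) by (auto simp: Ax_def Dx_def)
  qed
  have DX0: "D \<subseteq> X0"
  proof
    fix x assume x: "x \<in> D"
    have "Ax x \<subseteq> {x}" using D(2) x by (auto simp: Ax_def clique_def)
    then have "card (Ax x) \<le> 1" using card_mono[of "{x}" "Ax x"] by simp
    then show "x \<in> X0" using x D(1) by (auto simp: X0_def)
  qed
  have X1: "card (Dx x) \<le> C" if "x \<in> X1" for x
  proof -
    have "x \<in> VB K" "x \<notin> D" "C + 1 < card (Ax x)" using that DX0 by (auto simp: X1_def X0_def)
    then show ?thesis
      using few_gray_or_few_white[OF K p core D(1,2) _ _ C, of x] by (simp add: Ax_def Dx_def)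
  qed
  have double: "(\<Sum>d\<in>D. sum \<mu> (Wd d \<inter> X)) = (\<Sum>x\<in>X. \<mu> x * card (Dx x))" if "X \<subseteq> VB K" for X
  proof -
    have fX: "finite X" using that finB finite_subset by auto
    have "(\<Sum>d\<in>D. sum \<mu> (Wd d \<inter> X)) = (\<Sum>d\<in>D. \<Sum>x\<in>X. if {x, d} \<in> EW K then \<mu> x else 0)"
    proof (rule sum.cong)
      fix d
      have "Wd d \<inter> X = X \<inter> {x. {x, d} \<in> EW K}" using that by (auto simp: Wd_def)
      then show "sum \<mu> (Wd d \<inter> X) = (\<Sum>x\<in>X. if {x, d} \<in> EW K then \<mu> x else 0)"
        using fX by (simp add: sum.If_cases)
    qed simp
    also have "\<dots> = (\<Sum>x\<in>X. \<Sum>d\<in>D. if {x, d} \<in> EW K then \<mu> x else 0)" by (rule sum.swap)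
    also have "\<dots> = (\<Sum>x\<in>X. \<mu> x * card (Dx x))"
    proof (rule sum.cong)
      fix x
      have "Dx x = D \<inter> {d. {x, d} \<in> EW K}" by (auto simp: Dx_def)
      then show "(\<Sum>d\<in>D. if {x, d} \<in> EW K then \<mu> x else 0) = \<mu> x * card (Dx x)"
        using finB by (simp add: sum.If_cases)
    qed simp
    finally show ?thesis .
  qed
  have Wd_mass: "p * sum \<mu> (Wd d) \<le> g" if "d \<in> D" for d
  proof -
    have "p * sum \<mu> (Wd d) = (\<Sum>x\<in>Wd d. crg_matrix K p d x * \<mu> x)"
      unfolding sum_distrib_left
      by (intro sum.cong) (auto simp: Wd_def crg_matrix_def insert_commute)
    also have "\<dots> \<le> potential K p \<mu> d"
      unfolding potential_def using fin nn crg_matrix_bounds(1)[of p] p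
      by (intro sum_mono2) (auto simp: Wd_def crg_verts_def intro!: mult_nonneg_nonneg)
    also have "\<dots> = g" using that D(1) by (intro pot) (auto simp: crg_verts_def)
    finally show ?thesis .
  qed
  have X0: "p * sum \<mu> X0 \<le> g * L / (real L - (real C + 1))"
  proof -
    have "sum \<mu> X0 * (real L - (real C + 1)) = (\<Sum>x\<in>X0. \<mu> x * (real L - (real C + 1)))"
      by (rule sum_distrib_right)
    also have "\<dots> \<le> (\<Sum>x\<in>X0. \<mu> x * card (Dx x))"
    proof (intro sum_mono mult_left_mono nn)
      fix x assume "x \<in> X0"
      then have "card (Ax x) \<le> C + 1" by (simp add: X0_def)
      then have "L \<le> card (Dx x) + (C + 1)" using Dsplit[of x] by linarith
      then show "real L - (real C + 1) \<le> card (Dx x)" by linarith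
    qed
    also have "\<dots> = (\<Sum>d\<in>D. sum \<mu> (Wd d \<inter> X0))"
      by (rule double[symmetric]) (auto simp: X0_def)
    also have "\<dots> \<le> (\<Sum>d\<in>D. sum \<mu> (Wd d))"
      using finB nn by (intro sum_mono sum_mono2) (auto simp: Wd_def)
    finally have "p * (sum \<mu> X0 * (real L - (real C + 1))) \<le> p * (\<Sum>d\<in>D. sum \<mu> (Wd d))"
      using p by (intro mult_left_mono) auto
    also have "\<dots> = (\<Sum>d\<in>D. p * sum \<mu> (Wd d))" by (rule sum_distrib_left)
    also have "\<dots> \<le> (\<Sum>d\<in>D. g)" by (intro sum_mono Wd_mass)
    also have "\<dots> = g * L" using D(3) by simp
    finally have "p * sum \<mu> X0 * (real L - (real C + 1)) \<le> g * L" by (simp add: mult.assoc)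
    then show ?thesis using L(1) by (simp add: pos_le_divide_eq)
  qed
  define c where "c = (\<lambda>d. sum \<mu> (Wd d \<inter> X1))"
  \<comment> \<open>The average of \<open>c\<close> over \<open>D\<close> is at most \<open>C / L\<close>, so at least half of \<open>D\<close> is good.\<close>
  define Good where "Good = {d \<in> D. c d \<le> 2 * C / L}"
  have Lpos: "0 < real L" using L by simp
  have c_nn: "0 \<le> c d" for d unfolding c_def using nn by (intro sum_nonneg) auto
  have "(\<Sum>d\<in>D. c d) \<le> C"
  proof -
    have "(\<Sum>d\<in>D. c d) = (\<Sum>x\<in>X1. \<mu> x * card (Dx x))"
      unfolding c_def by (rule double) (auto simp: X1_def)
    also have "\<dots> \<le> (\<Sum>x\<in>X1. \<mu> x * C)"
      using X1 nn by (intro sum_mono mult_left_mono) auto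
    also have "\<dots> = sum \<mu> X1 * C" by (simp add: sum_distrib_right)
    also have "\<dots> \<le> sum \<mu> (crg_verts K) * C"
      using fin nn by (intro mult_right_mono sum_mono2) (auto simp: X1_def crg_verts_def)
    finally show ?thesis using \<mu> by (simp add: prob_masses_def)
  qed
  moreover have "real (card (D - Good)) * (2 * C / L) \<le> (\<Sum>d\<in>D. c d)"
  proof -
    have "real (card (D - Good)) * (2 * C / L) \<le> (\<Sum>d\<in>D - Good. c d)"
      by (rule sum_bounded_below) (auto simp: Good_def)
    also have "\<dots> \<le> (\<Sum>d\<in>D. c d)" using finB c_nn by (intro sum_mono2) auto
    finally show ?thesis .
  qed
  ultimately have "real (card (D - Good)) * (2 * C / L) \<le> C" by linarith
  then have "real C * (2 * card (D - Good)) \<le> real C * L"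
    using Lpos by (simp add: field_simps)
  then have "2 * card (D - Good) \<le> L" using C0 by (simp flip: of_nat_mult)
  moreover have "card Good + card (D - Good) = L"
    using card_Diff_subset[of Good D] card_mono[of D Good] finB D(3) by (auto simp: Good_def)
  ultimately have "l \<le> card Good" using L(2) by linarith
  then obtain D' where D': "D' \<subseteq> Good" "card D' = l"
    using obtain_subset_with_card_n by metis
  have finD': "finite D'" using D' finB by (auto simp: Good_def intro: finite_subset)
  have "p * sum \<mu> (white_nbhd K D') \<le> p * (sum \<mu> X0 + (\<Sum>d\<in>D'. c d))"
  proof (intro mult_left_mono)
    have sub: "white_nbhd K D' \<subseteq> X0 \<union> (\<Union>d\<in>D'. Wd d \<inter> X1)"
      using D' DX0 by (auto simp: white_nbhd_def Good_def Wd_def X1_def)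
    have fX: "finite X0" "finite (\<Union>d\<in>D'. Wd d \<inter> X1)"
      using finB finD' by (auto simp: X0_def Wd_def)
    have "sum \<mu> (white_nbhd K D') \<le> sum \<mu> (X0 \<union> (\<Union>d\<in>D'. Wd d \<inter> X1))"
      using sub fX nn by (intro sum_mono2) auto
    also have "\<dots> \<le> sum \<mu> X0 + sum \<mu> (\<Union>d\<in>D'. Wd d \<inter> X1)"
      using fX nn sum.union_inter[OF fX, of \<mu>] sum_nonneg[of "X0 \<inter> (\<Union>d\<in>D'. Wd d \<inter> X1)" \<mu>] by simp
    also have "sum \<mu> (\<Union>d\<in>D'. Wd d \<inter> X1) \<le> (\<Sum>d\<in>D'. c d)"
      unfolding c_def using finD' finB nn by (intro sum_UN_le) (auto simp: Wd_def)
    finally show "sum \<mu> (white_nbhd K D') \<le> sum \<mu> X0 + (\<Sum>d\<in>D'. c d)" by simp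
  qed (use p in simp)
  also have "\<dots> = p * sum \<mu> X0 + p * (\<Sum>d\<in>D'. c d)" by (simp add: distrib_left)
  also have "p * (\<Sum>d\<in>D'. c d) \<le> 2 * real l * real C / real L"
  proof -
    have "(\<Sum>d\<in>D'. c d) \<le> real (card D') * (2 * C / L)"
      using D' by (intro sum_bounded_above) (auto simp: Good_def)
    moreover have "p * (\<Sum>d\<in>D'. c d) \<le> (\<Sum>d\<in>D'. c d)"
      using p c_nn by (intro mult_left_le_one_le sum_nonneg) auto
    ultimately show ?thesis using D'(2) by (simp add: mult_ac)
  qed
  also note X0
  finally have "p * sum \<mu> (white_nbhd K D') \<le> g * L / (real L - (real C + 1)) + 2 * real l * real C / real L" by simp
  moreover have "D' \<subseteq> D" using D' by (auto simp: Good_def)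
  ultimately show thesis using that D'(2) by blast
qed

text \<open>Merging such a subclique and passing to the core yields a core CRG with one more white vertex,
  which may be replaced by a dalmatian in addition to the previous ones. Its value exceeds the old
  one by an error that vanishes as the clique grows.\<close>

lemma add_white_vertex:
  fixes K :: "nat crg"
  assumes K: "is_crg K" and p: "0 < p" "p < 1/2" and core: "p_core p K"
    and D: "D \<subseteq> VB K" "clique D (EW K)" "card D = L"
    and C: "2 * ((1 - p) / p)\<^sup>2 \<le> real C" and L: "C + 1 < L" "2 * l \<le> L" and l: "1 \<le> l"
    and S: "S \<subseteq> VW K" and F: "\<not> family_maps_to \<F> (dalmatian_blowup K S l)"
  shows "\<exists>(K' :: nat crg) S'. is_crg K' \<and> p_core p K' \<and> S' \<subseteq> VW K' \<and> card S' = Suc (card S) \<and>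
    card (VW K') = Suc (card (VW K)) \<and>
    g_crg K' p \<le> g_crg K p + (real C + 1 + 2 * real l * real C) / (real L - (real C + 1)) \<and>
    \<not> family_maps_to \<F> (dalmatian_blowup K' S' l)"
proof -
  let ?V = "crg_verts K" and ?g = "g_crg K p"
  have fin: "finite ?V" using K by (simp add: is_crg_def)
  have p1: "p < 1" using p by simp
  have zero: "p_core 0 K" by (rule p_core_imp_zero_core[OF K p core])
  obtain \<mu> where \<mu>: "\<mu> \<in> prob_masses ?V"
    and pot: "\<And>x. x \<in> ?V \<Longrightarrow> potential K p \<mu> x = ?g"
    by (rule p_core_optimum[OF K p(1) p1 core]) (rule that)
  obtain D' where D': "D' \<subseteq> D" "card D' = l"
    and mass: "p * sum \<mu> (white_nbhd K D') \<le> ?g * L / (real L - (real C + 1)) + 2 * real l * real C / real L"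
    by (rule subclique_small_white_nbhd[OF K p core \<mu> pot D C L])
  obtain v where v: "v \<notin> ?V" using fin ex_new_if_finite infinite_UNIV_nat by metis
  define R where "R = white_nbhd K D'"
  define M where "M = merge_white K R v"
  have R: "R \<subseteq> VB K" by (auto simp: R_def white_nbhd_def)
  have M: "is_crg M" "p_core 0 M" unfolding M_def by (rule is_crg_merge_white[OF K R v])+
  define err where "err = (real C + 1 + 2 * real l * real C) / (real L - (real C + 1))"
  have Lp: "0 < real L - (real C + 1)" using L(1) by linarith
  have "?g * L / (real L - (real C + 1)) + 2 * real l * real C / real L \<le> ?g + err"
  proof -
    have g: "0 \<le> ?g" "?g \<le> 1" using g_crg_bounds[OF K, of p] p by auto
    have "?g * L / (real L - (real C + 1)) = ?g * (real L / (real L - (real C + 1)))"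
      using L(1) by (simp add: of_nat_diff)
    also have "real L / (real L - (real C + 1)) = 1 + (real C + 1) / (real L - (real C + 1))"
      using Lp by (simp add: field_simps)
    also have "?g * (1 + (real C + 1) / (real L - (real C + 1))) = ?g + ?g * ((real C + 1) / (real L - (real C + 1)))"
      by (simp add: distrib_left)
    also have "?g * ((real C + 1) / (real L - (real C + 1))) \<le> (real C + 1) / (real L - (real C + 1))"
      using g Lp by (intro mult_left_le_one_le) auto
    finally have "?g * L / (real L - (real C + 1)) \<le> ?g + (real C + 1) / (real L - (real C + 1))" by simp
    moreover have "2 * real l * real C / real L \<le> 2 * real l * real C / (real L - (real C + 1))"
      using Lp by (intro divide_left_mono) auto
    ultimately show ?thesis by (simp add: err_def add_divide_distrib)
  qed
  then have "p * sum \<mu> R - ?g \<le> err" using mass by (simp add: R_def)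
  moreover have "0 \<le> sum \<mu> R" "sum \<mu> R \<le> 1"
  proof -
    have nn: "0 \<le> \<mu> x" for x using \<mu> by (cases "x \<in> ?V") (auto simp: prob_masses_def)
    show "0 \<le> sum \<mu> R" using nn by (intro sum_nonneg) auto
    have "sum \<mu> R \<le> sum \<mu> ?V" using fin nn R by (intro sum_mono2) (auto simp: crg_verts_def)
    then show "sum \<mu> R \<le> 1" using \<mu> by (simp add: prob_masses_def)
  qed
  moreover have "0 \<le> err" using Lp by (simp add: err_def)
  ultimately have "sum \<mu> R * (p * sum \<mu> R - ?g) \<le> err"
    by (meson mult_left_le_one_le mult_left_mono order_trans)
  then have gM: "g_crg M p \<le> ?g + err"
    using g_merge_white_le[OF K p core R v \<mu> pot] unfolding M_def by linarith
  obtain U where U: "U \<noteq> {}" "U \<subseteq> crg_verts M" "VW M \<subseteq> U" "p_core p (sub_crg M U)"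
    "g_crg (sub_crg M U) p \<le> g_crg M p"
    by (rule core_sub_crg_exists[OF M p(1) p1])
  have VWM: "VW (sub_crg M U) = insert v (VW K)"
    using U(3) by (auto simp: sub_crg_def M_def merge_white_def)
  have vW: "v \<notin> VW K" "v \<notin> S" using v S by (auto simp: crg_verts_def)
  have finW: "finite (VW K)" "finite S" using fin S by (auto simp: crg_verts_def intro: finite_subset)
  have D'_clique: "clique D' (EW K)" "D' \<subseteq> VB K"
    using smaller_clique[OF D(2) D'(1)] D' D by auto
  obtain h where h: "crg_hom h (dalmatian_blowup M (insert v S) l) (dalmatian_blowup K S l)"
    using blowup_merge_white_hom[OF K zero v D'_clique(2,1) D'(2) l S] by (auto simp: M_def R_def)
  have "\<not> family_maps_to \<F> (dalmatian_blowup (sub_crg M U) (insert v S) l)"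
    using F family_maps_to_hom[OF h] family_maps_to_hom[OF crg_hom_blowup_sub] by blast
  moreover have "g_crg (sub_crg M U) p \<le> ?g + (real C + 1 + 2 * real l * real C) / (real L - (real C + 1))"
    using U(5) gM by (simp add: err_def)
  ultimately show ?thesis
    using is_crg_sub[OF M(1) U(1,2)] U(4) VWM S vW finW
    by (intro exI[of _ "sub_crg M U"] exI[of _ "insert v S"]) auto
qed

section \<open>Relabelling\<close>

definition map_crg :: "('a \<Rightarrow> 'b) \<Rightarrow> 'a crg \<Rightarrow> 'b crg" where
  "map_crg f K = \<lparr>VB = f ` VB K, VW = f ` VW K, EB = (`) f ` EB K, EW = (`) f ` EW K,
     EG = (`) f ` EG K\<rparr>"

lemma map_crg_verts: "crg_verts (map_crg f K) = f ` crg_verts K"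
  by (auto simp: map_crg_def crg_verts_def)

lemma is_crg_edges_Pow:
  assumes "is_crg K"
  shows "EB K \<subseteq> Pow (crg_verts K)" "EW K \<subseteq> Pow (crg_verts K)" "EG K \<subseteq> Pow (crg_verts K)"
  using assms by (auto simp: is_crg_def nsets_def)

lemma is_crg_map:
  assumes K: "is_crg K" and f: "inj_on f (crg_verts K)"
  shows "is_crg (map_crg f K)"
proof -
  note P = is_crg_edges_Pow[OF K]
  have inj: "inj_on ((`) f) (Pow (crg_verts K))" using f by (simp add: inj_on_image_Pow)
  have "(`) f ` nsets (crg_verts K) 2 = nsets (f ` crg_verts K) 2"
    using bij_betw_nsets[of f "crg_verts K" "f ` crg_verts K" 2] f
    by (simp add: bij_betw_def)
  moreover have "nsets (crg_verts K) 2 = EB K \<union> EW K \<union> EG K" using K by (simp add: is_crg_def)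
  ultimately have E: "(`) f ` EB K \<union> (`) f ` EW K \<union> (`) f ` EG K = nsets (f ` crg_verts K) 2"
    by (simp add: image_Un)
  have disj: "(`) f ` X \<inter> (`) f ` Y = {}"
    if "X \<inter> Y = {}" "X \<subseteq> Pow (crg_verts K)" "Y \<subseteq> Pow (crg_verts K)" for X Y
    using inj_on_image_Int[OF inj that(2,3)] that(1) by simp
  have "f ` VB K \<inter> f ` VW K = {}"
    using inj_on_image_Int[OF f, of "VB K" "VW K"] K by (auto simp: is_crg_def crg_verts_def)
  then show ?thesis
    using K E P unfolding is_crg_def map_crg_verts by (auto simp: map_crg_def disj)
qed

lemma zero_core_map:
  assumes "p_core 0 K" "inj_on f (VB K)"
  shows "p_core 0 (map_crg f K)"
proof -
  have "(`) f ` nsets (VB K) 2 = nsets (f ` VB K) 2"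
    using bij_betw_nsets[of f "VB K" "f ` VB K" 2] assms(2) by (simp add: bij_betw_def)
  then show ?thesis using assms(1) by (auto simp: p_core_def map_crg_def)
qed

lemma g_crg_map_le:
  assumes K: "is_crg K" and f: "inj_on f (crg_verts K)"
  shows "g_crg (map_crg f K) p \<le> g_crg K p"
proof -
  let ?V = "crg_verts K" and ?L = "map_crg f K"
  obtain \<mu> where \<mu>: "\<mu> \<in> prob_masses ?V" "g_crg K p = crg_form K p \<mu>"
    using g_crg_attained[OF K] by blast
  define \<nu> where "\<nu> = (\<lambda>y. if y \<in> f ` ?V then \<mu> (inv_into ?V f y) else 0)"
  have \<nu>: "\<nu> (f x) = \<mu> x" if "x \<in> ?V" for x using that f by (simp add: \<nu>_def)
  have "sum \<nu> (f ` ?V) = sum \<mu> ?V" using f \<nu> by (simp add: sum.reindex)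
  then have "\<nu> \<in> prob_masses (crg_verts ?L)"
    using \<mu>(1) \<nu> by (auto simp: prob_masses_def map_crg_verts) (auto simp: \<nu>_def)
  then have "g_crg ?L p \<le> crg_form ?L p \<nu>" by (rule g_crg_le[OF is_crg_map[OF K f]])
  also have "\<dots> = crg_form K p \<mu>"
  proof -
    have edge: "{f x, f y} \<in> (`) f ` E \<longleftrightarrow> {x, y} \<in> E"
      if "E \<subseteq> Pow ?V" "x \<in> ?V" "y \<in> ?V" for E x y
      using inj_on_image_mem_iff[OF inj_on_image_Pow[OF f], of "{x, y}" E] that by simp
    have vert: "f x \<in> f ` X \<longleftrightarrow> x \<in> X" if "x \<in> ?V" "X \<subseteq> ?V" for x X
      using inj_on_image_mem_iff[OF f] that by blast
    have "crg_matrix ?L p (f x) (f y) = crg_matrix K p x y" if "x \<in> ?V" "y \<in> ?V" for x y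
    proof -
      have "{f x, f y} \<in> (`) f ` EB K \<longleftrightarrow> {x, y} \<in> EB K"
        "{f x, f y} \<in> (`) f ` EW K \<longleftrightarrow> {x, y} \<in> EW K"
        using edge that is_crg_edges_Pow[OF K] by blast+
      moreover have "f x \<in> f ` VB K \<longleftrightarrow> x \<in> VB K" "f x \<in> f ` VW K \<longleftrightarrow> x \<in> VW K"
        using vert that by (auto simp: crg_verts_def)
      moreover have "f x = f y \<longleftrightarrow> x = y" using inj_on_eq_iff[OF f that] .
      ultimately show ?thesis unfolding crg_matrix_def map_crg_def crg.select_convs by (simp only:)
    qed
    then show ?thesis
      using f \<nu> by (simp add: crg_form_def map_crg_verts sum.reindex cong: sum.cong)
  qed
  finally show ?thesis using \<mu>(2) by simp
qed

lemma blowup_unmap_hom: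
  assumes K: "is_crg K" and f: "inj_on f (crg_verts K)" and S: "S \<subseteq> VW K"
  shows "crg_hom (map_prod (inv_into (crg_verts K) f) id)
    (dalmatian_blowup (map_crg f K) (f ` S) l) (dalmatian_blowup K S l)"
proof -
  let ?g = "inv_into (crg_verts K) f"
  have SV: "S \<subseteq> crg_verts K" "VB K \<subseteq> crg_verts K" "VW K \<subseteq> crg_verts K"
    using S by (auto simp: crg_verts_def)
  have g: "?g (f x) = x" if "x \<in> crg_verts K" for x using that f by simp
  have vert: "?g y \<in> X" "y \<in> f ` crg_verts K" if "y \<in> f ` X" "X \<subseteq> crg_verts K" for y X
    using that g by auto
  have fS: "?g y \<in> S \<longleftrightarrow> y \<in> f ` S" if "y \<in> f ` crg_verts K" for y
    using that g SV f inj_on_image_mem_iff[OF f _ SV(1)] by auto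
  have edge: "{?g x, ?g y} \<in> E" "x \<in> f ` crg_verts K" "y \<in> f ` crg_verts K"
    if xy: "{x, y} \<in> (`) f ` E" and E: "E \<subseteq> Pow (crg_verts K)" for x y E
  proof -
    obtain e where "{x, y} = f ` e" "e \<in> E" by (rule imageE[OF xy])
    then have e: "{x, y} = f ` e" "e \<in> E" "e \<subseteq> crg_verts K" using E by blast+
    have "{?g x, ?g y} = ?g ` {x, y}" by simp
    also have "\<dots> = e" unfolding e(1) by (rule inv_into_image_cancel[OF f e(3)])
    finally show "{?g x, ?g y} \<in> E" using e(2) by simp
    show "x \<in> f ` crg_verts K" "y \<in> f ` crg_verts K" using e by blast+
  qed
  note P = is_crg_edges_Pow[OF K]
  have inj: "x = y" if "?g x = ?g y" "x \<in> f ` crg_verts K" "y \<in> f ` crg_verts K" for x y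
    using that g by auto
  show ?thesis
    unfolding crg_hom_def
  proof (intro conjI allI impI)
    show "map_prod ?g id ` VB (dalmatian_blowup (map_crg f K) (f ` S) l) \<subseteq> VB (dalmatian_blowup K S l)"
      using vert[OF _ SV(1)] vert[OF _ SV(2)] fS
      by (fastforce simp: blowup_simps mem_fibre map_crg_def split: if_splits)
    show "map_prod ?g id ` VW (dalmatian_blowup (map_crg f K) (f ` S) l) \<subseteq> VW (dalmatian_blowup K S l)"
      using vert[OF _ SV(3)] fS
      by (fastforce simp: blowup_simps mem_fibre map_crg_def split: if_splits)
  next
    fix a b
    assume "{a, b} \<in> EB (dalmatian_blowup (map_crg f K) (f ` S) l)"
    then show "{map_prod ?g id a, map_prod ?g id b} \<in> EB (dalmatian_blowup K S l)"
      using edge[OF _ P(1), of "fst a" "fst b"] fS[of "fst a"] fS[of "fst b"]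
      by (auto simp: blowup_simps mem_fibre map_crg_def)
  next
    fix a b
    assume "{a, b} \<in> EG (dalmatian_blowup (map_crg f K) (f ` S) l)"
    then show "{map_prod ?g id a, map_prod ?g id b} \<in> EG (dalmatian_blowup K S l)"
      using edge[OF _ P(3), of "fst a" "fst b"] fS[of "fst a"] fS[of "fst b"]
      by (auto simp: blowup_simps mem_fibre map_crg_def)
  next
    fix a b
    assume ab: "{a, b} \<in> EW (dalmatian_blowup (map_crg f K) (f ` S) l)"
    obtain x i y j where [simp]: "a = (x, i)" "b = (y, j)" by (metis prod.exhaust)
    consider "{x, y} \<in> (`) f ` EW K" | "i \<noteq> j" "x = y" "x \<in> f ` S"
      using ab by (auto simp: blowup_simps map_crg_def)
    then show "{map_prod ?g id a, map_prod ?g id b} \<in> EW (dalmatian_blowup K S l)"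
    proof cases
      case 1
      then show ?thesis
        using ab edge[OF _ P(2), of x y] fS[of x] fS[of y]
        by (auto simp: blowup_simps mem_fibre map_crg_def)
    next
      case 2
      then have "?g x \<in> S" using vert(1)[OF _ SV(1)] by simp
      then show ?thesis using 2 ab by (auto simp: blowup_simps mem_fibre)
    qed
  qed
qed

lemma crg_iso_if_map_eq:
  assumes f: "inj_on f (crg_verts K)" and h: "inj_on h (crg_verts L)"
    and L: "is_crg L" and eq: "map_crg f K = map_crg h L"
  shows "crg_iso K L"
proof -
  let ?k = "inv_into (crg_verts L) h"
  have V: "f ` crg_verts K = h ` crg_verts L" using eq by (metis map_crg_verts)
  have cancel: "?k ` h ` X = X" if "X \<subseteq> crg_verts L" for X
    using inv_into_image_cancel[OF h that] .
  have cancelE: "(`) (?k \<circ> f) ` E = E'" if "(`) f ` E = (`) h ` E'" "E' \<subseteq> Pow (crg_verts L)" for E E'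
  proof -
    have "(`) (?k \<circ> f) ` E = (`) ?k ` (`) f ` E" by (simp add: image_image image_comp)
    also have "\<dots> = (\<lambda>e. ?k ` h ` e) ` E'" unfolding that(1) by (simp add: image_image)
    also have "\<dots> = (\<lambda>e. e) ` E'" using cancel that(2) by (intro image_cong) auto
    finally show ?thesis by simp
  qed
  have "bij_betw (?k \<circ> f) (crg_verts K) (crg_verts L)"
    using f h V by (intro bij_betw_trans[of f _ "h ` crg_verts L"] bij_betw_inv_into)
      (auto simp: bij_betw_def)
  moreover have "f ` VB K = h ` VB L" "f ` VW K = h ` VW L" and E: "(`) f ` EB K = (`) h ` EB L"
    "(`) f ` EW K = (`) h ` EW L" "(`) f ` EG K = (`) h ` EG L"
    using eq by (simp_all add: map_crg_def)
  then have "(?k \<circ> f) ` VB K = VB L" "(?k \<circ> f) ` VW K = VW L"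
    using cancel[of "VB L"] cancel[of "VW L"] unfolding image_comp[symmetric]
    by (simp_all add: crg_verts_def)
  ultimately show ?thesis
    unfolding crg_iso_def
    by (intro exI[of _ "?k \<circ> f"] conjI cancelE[OF E(1)] cancelE[OF E(2)] cancelE[OF E(3)]
        is_crg_edges_Pow[OF L])
qed

lemma exists_small_labels:
  assumes "finite V" "card V \<le> N"
  obtains f where "inj_on f V" "f ` V \<subseteq> {..<N::nat}"
  using card_le_inj[of V "{..<N}"] assms by auto

lemma finite_crgs:
  assumes "finite (V :: 'a set)"
  shows "finite {K :: 'a crg. is_crg K \<and> crg_verts K \<subseteq> V}"
proof -
  let ?c = "\<lambda>(a, b, c, d, e). \<lparr>VB = a, VW = b, EB = c, EW = d, EG = e\<rparr>"
  have "{K :: 'a crg. is_crg K \<and> crg_verts K \<subseteq> V}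
    \<subseteq> ?c ` (Pow V \<times> Pow V \<times> Pow (Pow V) \<times> Pow (Pow V) \<times> Pow (Pow V))"
  proof
    fix K :: "'a crg" assume "K \<in> {K. is_crg K \<and> crg_verts K \<subseteq> V}"
    then have K: "is_crg K" "crg_verts K \<subseteq> V" by auto
    have "EB K \<subseteq> Pow V" "EW K \<subseteq> Pow V" "EG K \<subseteq> Pow V"
      by (rule subset_trans[OF _ Pow_mono[OF K(2)]], rule is_crg_edges_Pow[OF K(1)])+
    moreover have "VB K \<subseteq> V" "VW K \<subseteq> V" using K(2) by (auto simp: crg_verts_def)
    ultimately have "(VB K, VW K, EB K, EW K, EG K)
        \<in> Pow V \<times> Pow V \<times> Pow (Pow V) \<times> Pow (Pow V) \<times> Pow (Pow V)"
      by (intro SigmaI PowI)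
    moreover have "K = ?c (VB K, VW K, EB K, EW K, EG K)" by simp
    ultimately show "K \<in> ?c ` (Pow V \<times> Pow V \<times> Pow (Pow V) \<times> Pow (Pow V) \<times> Pow (Pow V))"
      by (rule rev_image_eqI)
  qed
  then show ?thesis by (rule finite_subset) (use assms in auto)
qed

section \<open>Approximants\<close>

text \<open>An approximant with parameter \<open>r\<close> is a core CRG at a density near \<open>p\<close> with value almost at
  most \<open>\<gamma>\<close> and \<open>r\<close> white vertices more than \<open>w\<close>, of which \<open>r\<close> may be replaced by dalmatians of size
  \<open>l\<close> without receiving a member of the family. The sequence of the theorem provides approximants
  with \<open>r = 0\<close>, and the CRG to be found is a limit of approximants of bounded order.\<close>

definition approximant ::
  "nat graph set \<Rightarrow> real \<Rightarrow> real \<Rightarrow> nat \<Rightarrow> nat \<Rightarrow> real \<Rightarrow> nat \<Rightarrow> nat crg \<Rightarrow> bool" where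
  "approximant \<F> p \<gamma> w r \<epsilon> l K \<longleftrightarrow> is_crg K \<and> card (VW K) = w + r \<and>
     (\<exists>q. \<bar>q - p\<bar> < \<epsilon> \<and> 0 < q \<and> q < 1/2 \<and> p_core q K \<and> g_crg K q \<le> \<gamma> + \<epsilon>) \<and>
     (\<exists>S\<subseteq>VW K. card S = r \<and> \<not> family_maps_to \<F> (dalmatian_blowup K S l))"

lemma approximant_mono:
  assumes "approximant \<F> p \<gamma> w r \<epsilon> l K" "\<epsilon> \<le> \<delta>" "m \<le> l"
  shows "approximant \<F> p \<gamma> w r \<delta> m K"
proof -
  obtain q S where "\<bar>q - p\<bar> < \<epsilon>" "0 < q" "q < 1/2" "p_core q K" "g_crg K q \<le> \<gamma> + \<epsilon>"
    "S \<subseteq> VW K" "card S = r" "\<not> family_maps_to \<F> (dalmatian_blowup K S l)"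
    "is_crg K" "card (VW K) = w + r"
    using assms(1) unfolding approximant_def by blast
  moreover from this have "\<bar>q - p\<bar> < \<delta>" "g_crg K q \<le> \<gamma> + \<delta>" using assms(2) by linarith+
  moreover have "\<not> family_maps_to \<F> (dalmatian_blowup K S m)"
    using family_maps_to_hom[OF crg_hom_blowup_mono[OF assms(3)]] calculation by blast
  ultimately show ?thesis unfolding approximant_def by blast
qed

lemma zero_core_gray_clique:
  assumes K: "is_crg K" and zero: "p_core 0 K" and R: "R \<subseteq> crg_verts K" "indep R (EW K)"
  shows "clique R (EG K)"
  unfolding clique_def
proof (intro ballI impI)
  fix x y assume xy: "x \<in> R" "y \<in> R" "x \<noteq> y"
  then have "{x, y} \<in> EB K \<union> EW K \<union> EG K" using K R(1) by (auto simp: is_crg_def)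
  moreover have "{x, y} \<notin> EW K" using R(2) xy by (auto simp: indep_def)
  ultimately show "{x, y} \<in> EG K" using zero by (auto simp: p_core_def)
qed

text \<open>Members of the family bound the number of replaceable vertices, because white vertices of a
  0-core CRG are joined by gray edges.\<close>

lemma approximant_bound:
  assumes F: "F \<in> \<F>" "finite (verts F)" and l: "1 \<le> l" and A: "approximant \<F> p \<gamma> w r \<epsilon> l K"
  shows "r < card (verts F)"
proof (rule ccontr)
  assume r: "\<not> r < card (verts F)"
  obtain q S where K: "is_crg K" and q: "0 < q" "q < 1/2" "p_core q K"
    and S: "S \<subseteq> VW K" "card S = r" "\<not> family_maps_to \<F> (dalmatian_blowup K S l)"
    using A unfolding approximant_def by blast
  have zero: "EB K = {}" "EW K \<subseteq> nsets (VB K) 2" "VB K \<inter> VW K = {}"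
    using p_core_imp_zero_core[OF K q] K by (auto simp: p_core_def is_crg_def)
  have "indep S (EW K)"
    unfolding indep_def using subsetD[OF zero(2)] zero(3) S(1) by fastforce
  then have gray: "clique S (EG K)"
    using zero_core_gray_clique[OF K p_core_imp_zero_core[OF K q]] S(1) by (auto simp: crg_verts_def)
  have "finite S" using S(1) K by (auto simp: is_crg_def crg_verts_def intro: finite_subset)
  then have "maps_to F (dalmatian_blowup K S l)"
    using maps_to_gray_clique[OF _ gray S(1) l F(2)] S(2) r by auto
  then show False using S(3) F(1) by (auto simp: family_maps_to_def)
qed

text \<open>In a large approximant Ramsey's theorem gives a large white clique of black vertices, as gray
  cliques are bounded. Merging part of it yields one more replaceable white vertex.\<close>

lemma large_approximants_step:
  assumes p: "0 < p" and F: "F \<in> \<F>" "finite (verts F)"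
    and large: "\<And>\<epsilon> l N. 0 < \<epsilon> \<Longrightarrow> 1 \<le> l \<Longrightarrow> \<exists>K. approximant \<F> p \<gamma> w r \<epsilon> l K \<and> N < card (crg_verts K)"
    and \<epsilon>: "0 < \<epsilon>" and l: "1 \<le> l"
  shows "\<exists>K. approximant \<F> p \<gamma> w (Suc r) \<epsilon> l K"
proof -
  \<comment> \<open>For every \<open>q > p / 2\<close> one has \<open>2 * ((1 - q) / q)\<^sup>2 \<le> 8 / p\<^sup>2\<close>.\<close>
  define C where "C = nat \<lceil>8 / p\<^sup>2\<rceil>"
  define c where "c = real C + 1 + 2 * real l * real C"
  \<comment> \<open>Large enough for the merging error \<open>c / (L - (C + 1))\<close> to be at most \<open>\<epsilon> / 2\<close>.\<close>
  define L where "L = nat \<lceil>c / (\<epsilon> / 2)\<rceil> + C + 2 + 2 * l"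
  obtain n where n: "\<forall>(V :: nat set) E. finite V \<and> card V \<ge> n \<longrightarrow>
    (\<exists>R \<subseteq> V. card R = L \<and> clique R E \<or> card R = card (verts F) \<and> indep R E)"
    using ramsey2[of L "card (verts F)"] by blast
  define \<delta> where "\<delta> = min (\<epsilon> / 2) (p / 2)"
  have \<delta>: "0 < \<delta>" using p \<epsilon> by (simp add: \<delta>_def)
  obtain K where A: "approximant \<F> p \<gamma> w r \<delta> l K" and big: "n + w + r < card (crg_verts K)"
    using large[OF \<delta> l, of "n + w + r"] by blast
  obtain q S where K: "is_crg K" "card (VW K) = w + r"
    and q: "\<bar>q - p\<bar> < \<delta>" "0 < q" "q < 1/2" "p_core q K" "g_crg K q \<le> \<gamma> + \<delta>"
    and S: "S \<subseteq> VW K" "card S = r" "\<not> family_maps_to \<F> (dalmatian_blowup K S l)"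
    using A unfolding approximant_def by blast
  have fin: "finite (VB K)" "finite (VW K)" "VB K \<inter> VW K = {}"
    using K by (auto simp: is_crg_def crg_verts_def)
  have "card (crg_verts K) = card (VB K) + card (VW K)"
    unfolding crg_verts_def using fin by (rule card_Un_disjoint)
  then have "n \<le> card (VB K)" using big K by linarith
  then obtain R where R: "R \<subseteq> VB K"
    "card R = L \<and> clique R (EW K) \<or> card R = card (verts F) \<and> indep R (EW K)"
    using n fin by blast
  have white: "card R = L" "clique R (EW K)"
  proof -
    have "\<not> (card R = card (verts F) \<and> indep R (EW K))"
    proof
      assume R': "card R = card (verts F) \<and> indep R (EW K)"
      have "clique R (EG K)"
        using zero_core_gray_clique[OF K(1) p_core_imp_zero_core[OF K(1) q(2-4)]] R(1) R'
        by (auto simp: crg_verts_def)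
      moreover have "finite R" using R fin finite_subset by auto
      ultimately have "maps_to F (dalmatian_blowup K S l)"
        using maps_to_gray_clique[OF _ _ S(1) l F(2), of R] R(1) R' by auto
      then show False using S(3) F(1) by (auto simp: family_maps_to_def)
    qed
    then show "card R = L" "clique R (EW K)" using R(2) by auto
  qed
  have "p / 2 < q" using q(1) by (auto simp: \<delta>_def abs_if split: if_splits)
  then have "(1 - q) / q \<le> 1 / (p / 2)" using p q(2,3) by (intro frac_le) auto
  then have "(1 - q) / q \<le> 2 / p" by simp
  then have "((1 - q) / q)\<^sup>2 \<le> (2 / p)\<^sup>2" using q(2,3) by (intro power_mono) auto
  then have "2 * ((1 - q) / q)\<^sup>2 \<le> 8 / p\<^sup>2" by (simp add: power_divide)
  also have "\<dots> \<le> real C" by (simp add: C_def real_nat_ceiling_ge)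
  finally have C: "2 * ((1 - q) / q)\<^sup>2 \<le> real C" .
  have L: "C + 1 < L" "2 * l \<le> L" by (auto simp: L_def)
  obtain K' :: "nat crg" and S' where K': "is_crg K'" "p_core q K'" "S' \<subseteq> VW K'" "card S' = Suc (card S)"
    "card (VW K') = Suc (card (VW K))"
    "g_crg K' q \<le> g_crg K q + c / (real L - (real C + 1))"
    "\<not> family_maps_to \<F> (dalmatian_blowup K' S' l)"
    using add_white_vertex[OF K(1) q(2-4) R(1) white(2,1) C L l S(1,3), folded c_def]
    by blast
  have "c / (\<epsilon> / 2) \<le> real L - (real C + 1)"
    using real_nat_ceiling_ge[of "c / (\<epsilon> / 2)"] by (simp add: L_def)
  then have "c \<le> (real L - (real C + 1)) * (\<epsilon> / 2)"
    using \<epsilon> pos_divide_le_eq[of "\<epsilon> / 2" c] by simp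
  then have "c / (real L - (real C + 1)) \<le> \<epsilon> / 2"
    using L(1) by (simp add: pos_divide_le_eq mult.commute)
  moreover have "\<delta> \<le> \<epsilon> / 2" by (simp add: \<delta>_def)
  ultimately have "g_crg K' q \<le> \<gamma> + \<epsilon>" using K'(6) q(5) by argo
  moreover have "\<bar>q - p\<bar> < \<epsilon>" using q(1) \<epsilon> by (simp add: \<delta>_def)
  ultimately have "approximant \<F> p \<gamma> w (Suc r) \<epsilon> l K'"
    using K' K(2) S(2) q(2,3) unfolding approximant_def by auto
  then show ?thesis by blast
qed

text \<open>Up to relabelling there are only finitely many CRGs of bounded order, so one of them occurs
  for arbitrarily good approximations.\<close>

lemma bounded_approximants_limit:
  assumes bounded: "\<And>\<epsilon> l. 0 < \<epsilon> \<Longrightarrow> 1 \<le> l \<Longrightarrow> \<exists>K. approximant \<F> p \<gamma> w r \<epsilon> l K \<and> card (crg_verts K) \<le> N"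
  obtains K :: "nat crg" and S where "is_crg K" "p_core 0 K" "card (VW K) = w + r" "S \<subseteq> VW K"
    "card S = r" "g_crg K p \<le> \<gamma>" "\<And>l. \<not> family_maps_to \<F> (dalmatian_blowup K S l)"
proof -
  define good where "good = (\<lambda>m (K :: nat crg, S). is_crg K \<and> crg_verts K \<subseteq> {..<N} \<and> p_core 0 K \<and> card (VW K) = w + r \<and>
      S \<subseteq> VW K \<and> card S = r \<and> g_crg K p \<le> \<gamma> + 2 * (1 / real (Suc m)) \<and>
      \<not> family_maps_to \<F> (dalmatian_blowup K S (Suc m)))"
  have "\<exists>KS. good m KS" for m
  proof -
    let ?\<epsilon> = "1 / real (Suc m)"
    obtain K where A: "approximant \<F> p \<gamma> w r ?\<epsilon> (Suc m) K" and N: "card (crg_verts K) \<le> N"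
      using bounded[of ?\<epsilon> "Suc m"] by auto
    obtain q S where K: "is_crg K" "card (VW K) = w + r"
      and q: "\<bar>q - p\<bar> < ?\<epsilon>" "0 < q" "q < 1/2" "p_core q K" "g_crg K q \<le> \<gamma> + ?\<epsilon>"
      and S: "S \<subseteq> VW K" "card S = r" "\<not> family_maps_to \<F> (dalmatian_blowup K S (Suc m))"
      using A unfolding approximant_def by blast
    obtain f where f: "inj_on f (crg_verts K)" "f ` crg_verts K \<subseteq> {..<N}"
      using exists_small_labels[OF _ N] K by (auto simp: is_crg_def)
    have fW: "inj_on f (VB K)" "inj_on f (VW K)" "inj_on f S"
      using f(1) S(1) by (auto simp: crg_verts_def intro: inj_on_subset)
    have "g_crg (map_crg f K) p \<le> g_crg K q + \<bar>p - q\<bar>"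
      using g_crg_map_le[OF K(1) f(1), of p] g_crg_Lipschitz[OF K(1), of p q] by linarith
    then have "g_crg (map_crg f K) p \<le> \<gamma> + 2 * ?\<epsilon>" using q(1,5) by linarith
    moreover have "\<not> family_maps_to \<F> (dalmatian_blowup (map_crg f K) (f ` S) (Suc m))"
      using family_maps_to_hom[OF blowup_unmap_hom[OF K(1) f(1) S(1)]] S(3) by blast
    moreover have "card (VW (map_crg f K)) = w + r" "f ` S \<subseteq> VW (map_crg f K)" "card (f ` S) = r"
      using K(2) S(1,2) card_image[OF fW(2)] card_image[OF fW(3)] by (simp_all add: map_crg_def image_mono)
    moreover have "crg_verts (map_crg f K) \<subseteq> {..<N}" using f(2) by (simp add: map_crg_verts)
    moreover note is_crg_map[OF K(1) f(1)] zero_core_map[OF p_core_imp_zero_core[OF K(1) q(2-4)] fW(1)]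
    ultimately have "good m (map_crg f K, f ` S)" unfolding good_def prod.case by (intro conjI)
    then show ?thesis by blast
  qed
  then obtain s where s: "\<And>m. good m (s m)" by metis
  have "range s \<subseteq> {K. is_crg K \<and> crg_verts K \<subseteq> {..<N}} \<times> Pow {..<N}"
  proof (rule image_subsetI)
    fix m
    show "s m \<in> {K. is_crg K \<and> crg_verts K \<subseteq> {..<N}} \<times> Pow {..<N}"
      using s[of m] by (cases "s m") (auto simp: good_def crg_verts_def)
  qed
  then have "finite (range s)" by (rule finite_subset) (simp add: finite_crgs)
  then obtain m0 where m0: "infinite {m. s m = s m0}"
    using pigeonhole_infinite[of UNIV s] by auto
  obtain K S where KS: "s m0 = (K, S)" by (cases "s m0")
  have arb: "\<exists>m\<ge>k. good m (K, S)" for k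
  proof -
    obtain m where "m \<ge> k" "s m = s m0" using m0 unfolding infinite_nat_iff_unbounded_le by auto
    then show ?thesis using s[of m] KS by metis
  qed
  have "g_crg K p \<le> \<gamma>"
  proof (rule field_le_epsilon)
    fix e :: real assume e: "0 < e"
    obtain k where k: "1 / real (Suc k) < e / 2" using nat_approx_posE[of "e / 2"] e by auto
    obtain m where "m \<ge> k" "good m (K, S)" using arb by blast
    moreover have "1 / real (Suc m) \<le> 1 / real (Suc k)" using \<open>m \<ge> k\<close> by (simp add: frac_le)
    ultimately show "g_crg K p \<le> \<gamma> + e" using k by (auto simp: good_def)
  qed
  moreover have "\<not> family_maps_to \<F> (dalmatian_blowup K S l)" for l
  proof -
    obtain m where "m \<ge> l" "good m (K, S)" using arb by blast
    then show ?thesis using family_maps_to_hom[OF crg_hom_blowup_mono[of l "Suc m"]] by (auto simp: good_def)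
  qed
  ultimately show thesis using that[of K S] arb[of 0] by (auto simp: good_def)
qed

section \<open>From the sequence to the limit\<close>

text \<open>Pairwise non-isomorphic CRGs have unbounded order, and infinitely many of those in the
  sequence have exactly \<open>w\<close> white vertices.\<close>

lemma sequence_approximants:
  fixes \<Gamma> :: "nat \<Rightarrow> nat crg"
  assumes p: "0 < p" "p < 1/2" and q: "q \<longlonglongrightarrow> p"
    and \<Gamma>: "\<And>n. \<Gamma> n \<in> core_crgs (q n) \<F>"
    and w: "limsup (\<lambda>n. enat (card (VW (\<Gamma> n)))) = enat w"
    and \<gamma>: "limsup (\<lambda>n. ereal (g_crg (\<Gamma> n) (q n))) = ereal \<gamma>"
    and noniso: "\<And>m n. m \<noteq> n \<Longrightarrow> \<not> crg_iso (\<Gamma> m) (\<Gamma> n)"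
    and \<epsilon>: "0 < \<epsilon>"
  shows "\<exists>K. approximant \<F> p \<gamma> w 0 \<epsilon> l K \<and> N < card (crg_verts K)"
proof -
  have crg: "is_crg (\<Gamma> n)" "p_core (q n) (\<Gamma> n)" "\<not> family_maps_to \<F> (\<Gamma> n)" for n
    using \<Gamma>[of n] by (auto simp: core_crgs_def)
  have large: "eventually (\<lambda>n. N < card (crg_verts (\<Gamma> n))) sequentially"
  proof -
    define B where "B = {n. card (crg_verts (\<Gamma> n)) \<le> N}"
    have "\<exists>f. inj_on f (crg_verts (\<Gamma> n)) \<and> f ` crg_verts (\<Gamma> n) \<subseteq> {..<N}" if "n \<in> B" for n
      using exists_small_labels[of "crg_verts (\<Gamma> n)" N] crg(1)[of n] that
      by (auto simp: B_def is_crg_def)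
    then obtain f where f: "\<And>n. n \<in> B \<Longrightarrow> inj_on (f n) (crg_verts (\<Gamma> n))"
      "\<And>n. n \<in> B \<Longrightarrow> f n ` crg_verts (\<Gamma> n) \<subseteq> {..<N}" by metis
    have "(\<lambda>n. map_crg (f n) (\<Gamma> n)) ` B \<subseteq> {K. is_crg K \<and> crg_verts K \<subseteq> {..<N}}"
      using is_crg_map[OF crg(1) f(1)] f(2) by (intro image_subsetI) (simp add: map_crg_verts)
    then have "finite ((\<lambda>n. map_crg (f n) (\<Gamma> n)) ` B)"
      by (rule finite_subset) (simp add: finite_crgs)
    moreover have "inj_on (\<lambda>n. map_crg (f n) (\<Gamma> n)) B"
      using crg_iso_if_map_eq[OF f(1) f(1) crg(1)] noniso by (meson inj_onI)
    ultimately have "finite B" by (rule finite_imageD)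
    then have "eventually (\<lambda>n. n \<notin> B) sequentially"
      by (simp add: cofinite_eq_sequentially[symmetric] eventually_cofinite)
    then show ?thesis by (rule eventually_mono) (auto simp: B_def)
  qed
  have "eventually (\<lambda>n. enat (card (VW (\<Gamma> n))) < enat (Suc w)) sequentially"
    by (rule Limsup_lessD) (simp add: w)
  then have upper: "eventually (\<lambda>n. card (VW (\<Gamma> n)) \<le> w) sequentially"
    by (rule eventually_mono) simp
  have lower: "frequently (\<lambda>n. w \<le> card (VW (\<Gamma> n))) sequentially"
  proof (rule ccontr)
    assume "\<not> ?thesis"
    then have less: "eventually (\<lambda>n. card (VW (\<Gamma> n)) < w) sequentially"
      by (simp add: not_frequently not_le)
    then obtain n where "card (VW (\<Gamma> n)) < w" using eventually_happens by force
    then have w0: "0 < w" by simp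
    have "limsup (\<lambda>n. enat (card (VW (\<Gamma> n)))) \<le> enat (w - 1)"
      using less by (intro Limsup_bounded) (auto elim: eventually_mono)
    then show False using w w0 by simp
  qed
  have val: "eventually (\<lambda>n. g_crg (\<Gamma> n) (q n) < \<gamma> + \<epsilon>) sequentially"
  proof -
    have "eventually (\<lambda>n. ereal (g_crg (\<Gamma> n) (q n)) < ereal (\<gamma> + \<epsilon>)) sequentially"
      by (rule Limsup_lessD) (use \<epsilon> \<gamma> in simp)
    then show ?thesis by simp
  qed
  have near: "eventually (\<lambda>n. \<bar>q n - p\<bar> < \<epsilon>) sequentially"
    using tendstoD[OF q \<epsilon>] by (simp add: dist_real_def)
  have range: "eventually (\<lambda>n. 0 < q n) sequentially" "eventually (\<lambda>n. q n < 1/2) sequentially"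
    by (rule order_tendstoD[OF q], fact p)+
  have "frequently (\<lambda>n. (card (VW (\<Gamma> n)) \<le> w \<and> N < card (crg_verts (\<Gamma> n)) \<and>
      g_crg (\<Gamma> n) (q n) < \<gamma> + \<epsilon> \<and> \<bar>q n - p\<bar> < \<epsilon> \<and> 0 < q n \<and> q n < 1/2) \<and>
      w \<le> card (VW (\<Gamma> n))) sequentially"
    using lower eventually_conj[OF upper eventually_conj[OF large eventually_conj[OF val
        eventually_conj[OF near eventually_conj[OF range]]]]]
    by (rule frequently_eventually_conj)
  then obtain n where n: "card (VW (\<Gamma> n)) = w" "N < card (crg_verts (\<Gamma> n))"
    "g_crg (\<Gamma> n) (q n) < \<gamma> + \<epsilon>" "\<bar>q n - p\<bar> < \<epsilon>" "0 < q n" "q n < 1/2"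
    using frequently_ex by force
  have "\<not> family_maps_to \<F> (dalmatian_blowup (\<Gamma> n) {} l)"
    using family_maps_to_hom[OF crg_hom_unblow_empty] crg(3) by blast
  then have "approximant \<F> p \<gamma> w 0 \<epsilon> l (\<Gamma> n)"
    unfolding approximant_def using n crg(1,2)[of n]
    by (intro conjI exI[of _ "q n"] exI[of _ "{}"]) auto
  then show ?thesis using n(2) by blast
qed

text \<open>Approximants of unbounded order can be traded for approximants with larger \<open>r\<close>. As \<open>r\<close> is
  bounded, for some positive \<open>r\<close> there are arbitrarily good approximants of bounded order.\<close>

lemma bounded_approximants_exist:
  assumes p: "0 < p" and F: "F \<in> \<F>" "finite (verts F)"
    and start: "\<And>\<epsilon> l N. 0 < \<epsilon> \<Longrightarrow> 1 \<le> l \<Longrightarrow> \<exists>K. approximant \<F> p \<gamma> w 0 \<epsilon> l K \<and> N < card (crg_verts K)"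
  obtains (conclusion) r N where "1 \<le> r"
    "\<And>\<epsilon> l. 0 < \<epsilon> \<Longrightarrow> 1 \<le> l \<Longrightarrow> \<exists>K. approximant \<F> p \<gamma> w r \<epsilon> l K \<and> card (crg_verts K) \<le> N"
proof (rule ccontr)
  assume contra: "\<not> thesis"
  have unb: "\<exists>\<epsilon> l. 0 < \<epsilon> \<and> 1 \<le> l \<and> (\<forall>K. approximant \<F> p \<gamma> w r \<epsilon> l K \<longrightarrow> N < card (crg_verts K))"
    if r: "1 \<le> r" for r N
  proof (rule ccontr)
    assume "\<not> ?thesis"
    then have "\<exists>K. approximant \<F> p \<gamma> w r \<epsilon> l K \<and> card (crg_verts K) \<le> N" if "0 < \<epsilon>" "1 \<le> l" for \<epsilon> l
      using that by (meson not_le)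
    then show False using contra conclusion[OF r] by blast
  qed
  have "\<exists>K. approximant \<F> p \<gamma> w r \<epsilon> l K \<and> N < card (crg_verts K)" if "0 < \<epsilon>" "1 \<le> l" for r \<epsilon> l N
    using that
  proof (induction r arbitrary: \<epsilon> l N)
    case 0
    then show ?case by (rule start)
  next
    case (Suc r)
    obtain \<delta> m where \<delta>: "0 < \<delta>" "1 \<le> m"
      "\<And>K. approximant \<F> p \<gamma> w (Suc r) \<delta> m K \<Longrightarrow> N < card (crg_verts K)"
      using unb[of "Suc r" N] by auto
    obtain K where K: "approximant \<F> p \<gamma> w (Suc r) (min \<epsilon> \<delta>) (max l m) K"
      using large_approximants_step[OF p F Suc.IH, of "min \<epsilon> \<delta>" "max l m"] Suc.prems \<delta>(1)
      by (auto simp: le_max_iff_disj)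
    have "approximant \<F> p \<gamma> w (Suc r) \<epsilon> l K" "approximant \<F> p \<gamma> w (Suc r) \<delta> m K"
      using approximant_mono[OF K] by auto
    then show ?case using \<delta>(3) by blast
  qed
  from this[of 1 1 "card (verts F)" 0] obtain K where "approximant \<F> p \<gamma> w (card (verts F)) 1 1 K"
    by auto
  then show False using approximant_bound[OF F, of 1] by blast
qed

theorem theorem4p18:
  fixes \<F> \<H> :: "nat graph set" and p :: real and \<Gamma> :: "nat \<Rightarrow> nat crg"
    and q :: "nat \<Rightarrow> real" and w :: nat
  assumes "\<F> \<noteq> {}" and "\<forall>F\<in>\<F>. simple_graph F"
    and "\<H> = Forb \<F>" and "nontrivial_property \<H>"
    and "0 < p" and "p < 1/2"
    and "\<forall>n. 0 \<le> q n \<and> q n \<le> 1" and "q \<longlonglongrightarrow> p" and "\<forall>n. \<Gamma> n \<in> core_crgs (q n) \<F>"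
    and "limsup (\<lambda>n. enat (card (VW (\<Gamma> n)))) = enat w"
    and "\<forall>m n. m \<noteq> n \<longrightarrow> \<not> crg_iso (\<Gamma> m) (\<Gamma> n)"
  shows "\<exists>K :: nat crg.
           K \<in> core_crgs p \<F> \<and>
           ereal (g_crg K p) \<le> limsup (\<lambda>n. ereal (g_crg (\<Gamma> n) (q n))) \<and>
           card (VW K) > w \<and>
           (\<forall>r l. 1 \<le> r \<and> r \<le> card (VW K) - w \<and> 1 \<le> l \<longrightarrow>
              (\<forall>S. S \<subseteq> VW K \<and> card S = r \<longrightarrow> \<not> family_maps_to \<F> (dalmatian_blowup K S l)))"
proof -
  have fin: "finite (verts F)" if "F \<in> \<F>" for F
    using assms(2) that by (auto simp: simple_graph_def)
  obtain F where F: "F \<in> \<F>" using assms(1) by blast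
  have p1: "p < 1" using assms(6) by simp
  let ?lim = "limsup (\<lambda>n. ereal (g_crg (\<Gamma> n) (q n)))"
  have g: "0 \<le> g_crg (\<Gamma> n) (q n)" "g_crg (\<Gamma> n) (q n) \<le> 1" for n
    using g_crg_bounds[of "\<Gamma> n" "q n"] assms(7,9) by (auto simp: core_crgs_def)
  have "?lim \<le> 1" using g by (intro Limsup_bounded) auto
  moreover have "0 \<le> ?lim"
    using g by (intro le_Limsup) auto
  ultimately obtain \<gamma> where \<gamma>: "?lim = ereal \<gamma>"
    by (cases ?lim) auto
  have start: "\<exists>K. approximant \<F> p \<gamma> w 0 \<epsilon> l K \<and> N < card (crg_verts K)" if "0 < \<epsilon>" for \<epsilon> l N
    using sequence_approximants[OF assms(5,6,8) _ assms(10) \<gamma> _ that] assms(9,11) by blast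
  obtain r N where r: "1 \<le> r"
    and bounded: "\<And>\<epsilon> l. 0 < \<epsilon> \<Longrightarrow> 1 \<le> l \<Longrightarrow> \<exists>K. approximant \<F> p \<gamma> w r \<epsilon> l K \<and> card (crg_verts K) \<le> N"
    using bounded_approximants_exist[OF assms(5) F fin[OF F] start] by blast
  obtain L :: "nat crg" and T where L: "is_crg L" "p_core 0 L" "card (VW L) = w + r"
    and T: "T \<subseteq> VW L" "card T = r" and gL: "g_crg L p \<le> \<gamma>"
    and avoid: "\<And>l. \<not> family_maps_to \<F> (dalmatian_blowup L T l)"
    using bounded_approximants_limit[OF bounded] by metis
  obtain U where U: "U \<noteq> {}" "U \<subseteq> crg_verts L" "VW L \<subseteq> U" "p_core p (sub_crg L U)"
    "g_crg (sub_crg L U) p \<le> g_crg L p"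
    by (rule core_sub_crg_exists[OF L(1,2) assms(5) p1])
  define K where "K = sub_crg L U"
  have K: "is_crg K" "p_core 0 K"
    using is_crg_sub[OF L(1) U(1,2)] p_core_imp_zero_core[OF _ assms(5,6)] U(4) by (auto simp: K_def)
  have VWK: "VW K = VW L" using U(3) by (auto simp: K_def sub_crg_def)
  \<comment> \<open>The case \<open>S = {}\<close> also covers \<open>K\<close> itself.\<close>
  have blowup: "\<not> family_maps_to \<F> (dalmatian_blowup K S l)" if S: "S \<subseteq> VW K" "card S \<le> r" for S l
  proof
    assume "family_maps_to \<F> (dalmatian_blowup K S l)"
    then obtain G where G: "G \<in> \<F>" "maps_to G (dalmatian_blowup K S l)"
      by (auto simp: family_maps_to_def)
    have "maps_to G (dalmatian_blowup K T (l + card (verts G) + 1))"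
      using maps_to_blowup_card_mono[OF K S(1) _ _ fin[OF G(1)] G(2), of T] T S(2) VWK by simp
    then have "maps_to G (dalmatian_blowup L T (l + card (verts G) + 1))"
      using maps_to_hom[OF crg_hom_blowup_sub] unfolding K_def by blast
    then show False using avoid G(1) by (auto simp: family_maps_to_def)
  qed
  have "\<not> family_maps_to \<F> K"
    using family_maps_to_hom[OF crg_hom_blowup_empty[of K 1]] blowup[of "{}" 1] by auto
  then have "K \<in> core_crgs p \<F>"
    using K(1) U(4) by (simp add: core_crgs_def K_def)
  moreover have "ereal (g_crg K p) \<le> ?lim"
    using U(5) gL \<gamma> by (simp add: K_def)
  ultimately show ?thesis
    using blowup L(3) r VWK by (intro exI[of _ K]) auto
qed

end
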